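(* For each $k\in\mathbb{N}$, there are (up to isomorphism) only finitely many $k$-vertex-critical (co-gem, house)-free graphs.
   Context: All graphs are finite, simple and undirected; $\mathbb{N}=\{1,2,3,\ldots\}$. A graph $G$ is $k$-vertex-critical if $\chi(G)=k$ and $\chi(G-v)<k$ for all $v\in V(G)$, where $\chi$ is the chromatic number. A graph is $(H_1,H_2)$-free if it contains neither $H_1$ nor $H_2$ as an induced subgraph. The co-gem is $P_4+P_1$, the disjoint union of a chordless path on four vertices and an isolated vertex. The house is the complement of the chordless path $P_5$ on five vertices. *)

theory Defs
  imports "Graph_Theory.Pair_Digraph" "Graph_Theory.Digraph_Isomorphism"
begin

text \<open>
  A finite simple undirected graph is an instance of the locale \<^locale>\<open>graph\<close>, that is, a
  finite, loop-free, symmetric digraph without parallel arcs; an edge \<open>uv\<close> is the pair of arcs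
  \<open>(u, v)\<close> and \<open>(v, u)\<close>. Concrete graphs are given as \<^typ>\<open>'a pair_pre_digraph\<close>.
\<close>

definition proper_colouring :: "('a, 'b) pre_digraph \<Rightarrow> nat \<Rightarrow> ('a \<Rightarrow> nat) \<Rightarrow> bool" where
  "proper_colouring G k c \<longleftrightarrow>
     c ` verts G \<subseteq> {..<k} \<and> (\<forall>(u, v) \<in> arcs_ends G. c u \<noteq> c v)"

definition chromatic_number :: "('a, 'b) pre_digraph \<Rightarrow> nat" where
  "chromatic_number G = (LEAST k. \<exists>c. proper_colouring G k c)"

definition vertex_critical :: "nat \<Rightarrow> ('a, 'b) pre_digraph \<Rightarrow> bool" where
  "vertex_critical k G \<longleftrightarrow>
     chromatic_number G = k \<and>
     (\<forall>v \<in> verts G. chromatic_number (pre_digraph.del_vert G v) < k)"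

definition induced_free :: "('c, 'd) pre_digraph \<Rightarrow> ('a, 'b) pre_digraph \<Rightarrow> bool" where
  "induced_free H G \<longleftrightarrow> \<not> (\<exists>H'. induced_subgraph H' G \<and> digraph_iso H H')"

text \<open>The index counts vertices, not edges.\<close>

definition path_graph :: "nat \<Rightarrow> nat pair_pre_digraph" (\<open>P\<^bsub>_\<^esub>\<close>) where
  "P\<^bsub>n\<^esub> = \<lparr> pverts = {..<n},
          parcs = {(i, j). i < n \<and> j < n \<and> (j = Suc i \<or> i = Suc j)} \<rparr>"

definition disjoint_union ::
    "'a pair_pre_digraph \<Rightarrow> 'b pair_pre_digraph \<Rightarrow> ('a + 'b) pair_pre_digraph" where
  "disjoint_union G H =
     \<lparr> pverts = pverts G <+> pverts H,
       parcs = map_prod Inl Inl ` parcs G \<union> map_prod Inr Inr ` parcs H \<rparr>"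

definition graph_complement :: "'a pair_pre_digraph \<Rightarrow> 'a pair_pre_digraph" where
  "graph_complement G =
     \<lparr> pverts = pverts G,
       parcs = {(u, v). u \<in> pverts G \<and> v \<in> pverts G \<and> u \<noteq> v \<and> (u, v) \<notin> parcs G} \<rparr>"

definition co_gem :: "(nat + nat) pair_pre_digraph" where
  "co_gem = disjoint_union P\<^bsub>4\<^esub> P\<^bsub>1\<^esub>"

definition house :: "nat pair_pre_digraph" where
  "house = graph_complement P\<^bsub>5\<^esub>"

end

theory Submission
  imports Defs
begin

text \<open>
  The whole argument takes place in the complement \<open>H\<close> of the given graph, and \<open>\<frown>\<close> denotes
  adjacency in \<open>H\<close>. There a colouring is a partition into cliques, so with \<open>k = m + 1\<close> criticality
  says that \<open>H\<close> cannot be covered by \<open>m\<close> cliques although \<open>H - x\<close> can, for every vertex \<open>x\<close>; in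
  particular stable sets of \<open>H\<close> have at most \<open>m + 1\<close> vertices. The forbidden induced subgraphs
  become \<open>P\<^sub>5\<close> and the gem, which is a \<open>P\<^sub>4\<close> together with a vertex adjacent to all of it. Since
  there are finitely many graphs on a bounded number of vertices, it remains to bound the
  order of \<open>H\<close>.

  A maximal stable set dominates \<open>H\<close>, so it suffices to bound a single neighbourhood \<open>N(v)\<close>. It
  contains no \<open>P\<^sub>4\<close>, because \<open>H\<close> has no gem. A set without \<open>P\<^sub>4\<close> splits, alternately, into the
  components of its non-adjacency relation, which are completely joined to each other, and
  into the components of \<open>\<frown>\<close>, which are not joined at all (\<open>separated_if_path4_free\<close>). A splitting
  of the second kind has at most \<open>m + 1\<close> parts and lowers the size of the largest stable set.
  What must be bounded is thus the number of components of non-adjacency in the parts \<open>Y\<close>,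
  called nodes below, that arise in this way.

  Criticality forbids twins, that is, two such components with the same neighbours outside
  (\<open>no_twins\<close>). Therefore any two components of \<open>Y\<close> are told apart by a vertex \<open>u\<close> that is neither \<open>v\<close>
  nor adjacent to \<open>v\<close>: exactly one of them belongs to the trace of \<open>u\<close>, the set of components in
  which \<open>u\<close> has a neighbour. Excluding gems makes the traces a laminar family, and it makes
  vertices with properly nested nonempty traces non-adjacent, so that chains of traces are
  short. The number of components is therefore bounded unless some trace, or the set of all
  components, contains many maximal proper subtraces (\<open>card_le_chain_bound\<close>).

  If there are many, the excluded subgraphs force a rigid picture (\<open>few_branches\<close>). All but at
  most one of the subtraces yield a block: they consist of a single component \<open>C\<^sub>i\<close>, and if \<open>Q\<^sub>i\<close>
  is the set of vertices with trace \<open>{C\<^sub>i}\<close>, then all the \<open>C\<^sub>i\<close> are joined to each other, all the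
  \<open>Q\<^sub>i\<close> are joined to each other, \<open>C\<^sub>i\<close> is joined to \<open>Q\<^sub>i\<close> and to no other \<open>Q\<^sub>j\<close>, and a vertex outside
  the blocks does not distinguish the blocks. Such blocks are interchangeable, and a critical
  graph has only few of them (\<open>few_blocks\<close>): delete one block and colour the rest with \<open>m\<close>
  colours; two of the other blocks use the same colours, by the pigeonhole principle, and
  these colours can be used again on the deleted block.
\<close>

section \<open>Clique colourings\<close>

definition clique_colouring :: "('a \<Rightarrow> 'a \<Rightarrow> bool) \<Rightarrow> ('a \<Rightarrow> nat) \<Rightarrow> 'a set \<Rightarrow> bool" where
  "clique_colouring e f B \<longleftrightarrow> (\<forall>x\<in>B. \<forall>y\<in>B. f x = f y \<longrightarrow> x = y \<or> e x y)"

definition coverable :: "('a \<Rightarrow> 'a \<Rightarrow> bool) \<Rightarrow> 'a set \<Rightarrow> nat \<Rightarrow> bool" where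
  "coverable e B n \<longleftrightarrow> (\<exists>f. f ` B \<subseteq> {..<n} \<and> clique_colouring e f B)"

text \<open>
  The clique cover number; it is the chromatic number of the complement.
\<close>

definition theta :: "('a \<Rightarrow> 'a \<Rightarrow> bool) \<Rightarrow> 'a set \<Rightarrow> nat" where
  "theta e B = (LEAST n. coverable e B n)"

lemma clique_colouring_subset:
  "clique_colouring e f B \<Longrightarrow> A \<subseteq> B \<Longrightarrow> clique_colouring e f A"
  unfolding clique_colouring_def by blast

lemma coverable_subset: "coverable e B n \<Longrightarrow> A \<subseteq> B \<Longrightarrow> coverable e A n"
  unfolding coverable_def by (meson clique_colouring_subset image_mono subset_trans)

lemma coverable_mono: "coverable e B n \<Longrightarrow> n \<le> n' \<Longrightarrow> coverable e B n'"
  unfolding coverable_def by (meson lessThan_subset_iff subset_trans)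

lemma clique_colouring_recode:
  assumes "clique_colouring e f B" "inj_on g (f ` B)"
  shows "clique_colouring e (g \<circ> f) B"
  using assms unfolding clique_colouring_def inj_on_def by auto

lemma coverable_if_colouring:
  assumes "clique_colouring e f B" "finite (f ` B)" "card (f ` B) \<le> n"
  shows "coverable e B n"
proof -
  obtain g where g: "bij_betw g (f ` B) {..<card (f ` B)}"
    using assms(2) ex_bij_betw_finite_nat atLeast0LessThan by metis
  have "g ` f ` B \<subseteq> {..<n}"
    using assms(3) g unfolding bij_betw_def by simp
  then have "(g \<circ> f) ` B \<subseteq> {..<n}"
    by (simp add: image_comp)
  moreover have "clique_colouring e (g \<circ> f) B"
    using clique_colouring_recode[OF assms(1)] g by (simp add: bij_betw_def)
  ultimately show ?thesis
    unfolding coverable_def by blast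
qed

lemma theta_le: "coverable e B n \<Longrightarrow> theta e B \<le> n"
  unfolding theta_def by (rule Least_le)

lemma coverable_theta:
  assumes "finite B" shows "coverable e B (theta e B)"
proof -
  obtain g :: "'a \<Rightarrow> nat" where "inj_on g B"
    using finite_imp_inj_to_nat_seg[OF assms] by blast
  then have "clique_colouring e g B"
    unfolding clique_colouring_def inj_on_def by blast
  then have "coverable e B (card (g ` B))"
    using assms by (intro coverable_if_colouring) auto
  then show ?thesis
    unfolding theta_def by (rule LeastI)
qed

lemma theta_le_card_image:
  "clique_colouring e f B \<Longrightarrow> finite B \<Longrightarrow> theta e B \<le> card (f ` B)"
  by (intro theta_le coverable_if_colouring) auto

lemma clique_colouring_into:
  assumes "finite B" "finite A" "theta e B \<le> card A"
  obtains f where "f ` B \<subseteq> A" "clique_colouring e f B"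
proof -
  obtain f where f: "f ` B \<subseteq> {..<theta e B}" "clique_colouring e f B"
    using coverable_theta[OF assms(1)] unfolding coverable_def by blast
  obtain g where g: "bij_betw g {..<card A} A"
    using ex_bij_betw_nat_finite[OF assms(2)] atLeast0LessThan by metis
  have sub: "f ` B \<subseteq> {..<card A}"
    using f(1) assms(3) by auto
  have "inj_on g (f ` B)"
    using g sub by (meson bij_betw_imp_inj_on inj_on_subset)
  then have "clique_colouring e (g \<circ> f) B"
    by (rule clique_colouring_recode[OF f(2)])
  moreover have "(g \<circ> f) ` B \<subseteq> A"
    using g sub by (auto simp: bij_betw_def)
  ultimately show ?thesis
    using that by blast
qed

text \<open>
  The step behind all recolouring arguments: a colouring of the rest extends over \<open>P \<union> Q\<close> as
  soon as enough colours are available for which all vertices of the rest wearing them are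
  joined to \<open>P\<close>, respectively to \<open>Q\<close>. The two colour sets may overlap because \<open>P\<close> and \<open>Q\<close> are joined
  completely.
\<close>

lemma extend_colouring:
  assumes sym: "symp e"
    and fin: "finite P" "finite Q" and V: "P \<subseteq> V" "Q \<subseteq> V"
    and PQ: "\<And>x y. x \<in> P \<Longrightarrow> y \<in> Q \<Longrightarrow> e x y"
    and c: "clique_colouring e c (V - (P \<union> Q))"
    and colours: "finite A" "theta e P \<le> card A" "A \<subseteq> {..<n}"
       "finite A'" "theta e Q \<le> card A'" "A' \<subseteq> {..<n}" "c ` (V - (P \<union> Q)) \<subseteq> {..<n}"
    and A: "\<And>x w. x \<in> P \<Longrightarrow> w \<in> V - (P \<union> Q) \<Longrightarrow> c w \<in> A \<Longrightarrow> e x w"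
    and A': "\<And>x w. x \<in> Q \<Longrightarrow> w \<in> V - (P \<union> Q) \<Longrightarrow> c w \<in> A' \<Longrightarrow> e x w"
  shows "coverable e V n"
proof -
  obtain f where f: "f ` P \<subseteq> A" "clique_colouring e f P"
    using clique_colouring_into fin(1) colours(1,2) by metis
  obtain g where g: "g ` Q \<subseteq> A'" "clique_colouring e g Q"
    using clique_colouring_into fin(2) colours(4,5) by metis
  define h where "h x = (if x \<in> P then f x else if x \<in> Q then g x else c x)" for x
  have "h ` V \<subseteq> {..<n}"
  proof (intro image_subsetI)
    fix x assume "x \<in> V"
    then show "h x \<in> {..<n}"
      using f(1) g(1) colours(3,6,7) unfolding h_def
      by (cases "x \<in> P"; cases "x \<in> Q") (auto simp: image_subset_iff)
  qed
  moreover have "clique_colouring e h V"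
    unfolding clique_colouring_def
  proof (intro ballI impI)
    fix x y assume xy: "x \<in> V" "y \<in> V" "h x = h y"
    have one: "x = y \<or> e x y" if "x \<in> V" "y \<in> V" "h x = h y" "x \<in> P" for x y
    proof -
      have fx: "f x \<in> A" using f(1) that(4) by auto
      consider "y \<in> P" | "y \<notin> P" "y \<in> Q" | "y \<notin> P" "y \<notin> Q" "y \<in> V - (P \<union> Q)"
        using \<open>y \<in> V\<close> by blast
      then show ?thesis
        using that fx f(2) PQ A unfolding h_def clique_colouring_def by cases auto
    qed
    have two: "x = y \<or> e x y" if "x \<in> V" "y \<in> V" "h x = h y" "x \<in> Q" "x \<notin> P" "y \<notin> P" for x y
    proof -
      have gx: "g x \<in> A'" using g(1) that(4) by auto
      consider "y \<in> Q" | "y \<notin> Q" "y \<in> V - (P \<union> Q)"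
        using \<open>y \<in> V\<close> \<open>y \<notin> P\<close> by blast
      then show ?thesis
        using that gx g(2) A' unfolding h_def clique_colouring_def by cases auto
    qed
    consider "x \<in> P" | "y \<in> P" | "x \<in> Q" "x \<notin> P" "y \<notin> P" | "y \<in> Q" "x \<notin> P" "y \<notin> P"
      | "x \<in> V - (P \<union> Q)" "y \<in> V - (P \<union> Q)"
      using xy(1,2) by blast
    then show "x = y \<or> e x y"
    proof cases
      case 5
      then show ?thesis using c xy(3) unfolding h_def clique_colouring_def by auto
    next
      case 1 then show ?thesis using one xy by blast
    next
      case 2 then show ?thesis using one[of y x] xy sympD[OF sym] by metis
    next
      case 3 then show ?thesis using two xy by blast
    next
      case 4 then show ?thesis using two[of y x] xy sympD[OF sym] by metis
    qed
  qed
  ultimately show ?thesis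
    unfolding coverable_def by blast
qed

section \<open>Components of a symmetric relation\<close>

text \<open>
  Connectedness, stated through cuts.
\<close>

definition linked :: "('a \<Rightarrow> 'a \<Rightarrow> bool) \<Rightarrow> 'a set \<Rightarrow> bool" where
  "linked R A \<longleftrightarrow> (\<forall>Z. A \<inter> Z \<noteq> {} \<longrightarrow> A - Z \<noteq> {} \<longrightarrow> (\<exists>a\<in>A \<inter> Z. \<exists>b\<in>A - Z. R a b))"

definition components :: "('a \<Rightarrow> 'a \<Rightarrow> bool) \<Rightarrow> 'a set \<Rightarrow> 'a set set" where
  "components R Y = Y // {(a, b) \<in> Y \<times> Y. R a b \<or> a = b}\<^sup>*"

lemma linkedE:
  assumes "linked R A" "a \<in> A" "P a" "b \<in> A" "\<not> P b"
  obtains a' b' where "a' \<in> A" "b' \<in> A" "P a'" "\<not> P b'" "R a' b'"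
proof -
  have "A \<inter> {x. P x} \<noteq> {}" "A - {x. P x} \<noteq> {}" using assms by auto
  then have "\<exists>a'\<in>A \<inter> {x. P x}. \<exists>b'\<in>A - {x. P x}. R a' b'"
    using assms(1) unfolding linked_def by simp
  then show ?thesis using that by auto
qed

context
  fixes R :: "'a \<Rightarrow> 'a \<Rightarrow> bool" and Y :: "'a set"
  assumes sym: "symp R"
begin

private definition "S = {(a, b) \<in> Y \<times> Y. R a b \<or> a = b}"

private lemma reach_in: "(a, b) \<in> S\<^sup>* \<Longrightarrow> a \<in> Y \<Longrightarrow> b \<in> Y"
  by (induction rule: rtrancl_induct) (auto simp: S_def)

private lemma sym_reach: "sym (S\<^sup>*)"
  by (rule sym_rtrancl) (use sympD[OF sym] in \<open>auto simp: S_def sym_def\<close>)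

private lemma component_iff: "C \<in> components R Y \<longleftrightarrow> (\<exists>x\<in>Y. C = S\<^sup>* `` {x})"
  unfolding components_def S_def quotient_def by auto

lemma component_subset: "C \<in> components R Y \<Longrightarrow> C \<subseteq> Y"
  using reach_in by (auto simp: component_iff)

lemma component_nonempty: "C \<in> components R Y \<Longrightarrow> C \<noteq> {}"
  by (auto simp: component_iff)

lemma Union_components: "\<Union> (components R Y) = Y"
proof
  show "\<Union> (components R Y) \<subseteq> Y" using component_subset by blast
  show "Y \<subseteq> \<Union> (components R Y)"
  proof
    fix x assume "x \<in> Y"
    then have "S\<^sup>* `` {x} \<in> components R Y" "x \<in> S\<^sup>* `` {x}" by (auto simp: component_iff)
    then show "x \<in> \<Union> (components R Y)" by blast
  qed
qed

lemma components_eqI: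
  assumes C: "C \<in> components R Y" "D \<in> components R Y" "x \<in> C" "x \<in> D"
  shows "C = D"
proof -
  obtain c d where cd: "C = S\<^sup>* `` {c}" "D = S\<^sup>* `` {d}" using C by (auto simp: component_iff)
  then have "(c, x) \<in> S\<^sup>*" "(d, x) \<in> S\<^sup>*" using C by auto
  then have "(c, d) \<in> S\<^sup>*" "(d, c) \<in> S\<^sup>*"
    using sym_reach by (meson rtrancl_trans symD)+
  then show ?thesis unfolding cd by (auto intro: rtrancl_trans)
qed

lemma components_not_related:
  assumes C: "C \<in> components R Y" "D \<in> components R Y" "C \<noteq> D" "a \<in> C" "b \<in> D"
  shows "\<not> R a b"
proof
  assume "R a b"
  obtain c where c: "C = S\<^sup>* `` {c}" using C by (auto simp: component_iff)
  have "a \<in> Y" "b \<in> Y" using C component_subset by auto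
  then have "(a, b) \<in> S" using \<open>R a b\<close> by (auto simp: S_def)
  then have "b \<in> C" using C(4) c by (auto intro: rtrancl_into_rtrancl)
  then show False using components_eqI C by blast
qed

lemma linked_component:
  assumes C: "C \<in> components R Y"
  shows "linked R C"
  unfolding linked_def
proof (intro allI impI)
  fix Z assume Z: "C \<inter> Z \<noteq> {}" "C - Z \<noteq> {}"
  obtain c where c: "C = S\<^sup>* `` {c}" using C by (auto simp: component_iff)
  obtain a b where ab: "a \<in> C \<inter> Z" "b \<in> C - Z" using Z by blast
  then have "(a, b) \<in> S\<^sup>*"
    using sym_reach unfolding c by (auto intro: rtrancl_trans dest: symD)
  then have "b \<in> C \<and> (b \<in> Z \<or> (\<exists>x\<in>C \<inter> Z. \<exists>y\<in>C - Z. R x y))"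
  proof (induction rule: rtrancl_induct)
    case base
    then show ?case using ab by blast
  next
    case (step x y)
    then have "y \<in> C" unfolding c by (auto intro: rtrancl_into_rtrancl)
    then show ?case using step S_def by auto
  qed
  then show "\<exists>x\<in>C \<inter> Z. \<exists>y\<in>C - Z. R x y" using ab by blast
qed

lemma finite_components: "finite Y \<Longrightarrow> finite (components R Y)"
  using Union_components finite_UnionD by metis

lemma obtain_component:
  assumes "x \<in> Y" obtains C where "C \<in> components R Y" "x \<in> C"
  using assms Union_components by blast

end

section \<open>Sets without an induced path on four vertices\<close>

definition nonadj :: "('a \<Rightarrow> 'a \<Rightarrow> bool) \<Rightarrow> 'a \<Rightarrow> 'a \<Rightarrow> bool" where
  "nonadj e x y \<longleftrightarrow> x \<noteq> y \<and> \<not> e x y"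

definition separated :: "('a \<Rightarrow> 'a \<Rightarrow> bool) \<Rightarrow> 'a set \<Rightarrow> bool" where
  "separated R X \<longleftrightarrow> (\<exists>Z. Z \<noteq> {} \<and> Z \<subset> X \<and> (\<forall>a\<in>Z. \<forall>b\<in>X - Z. \<not> R a b))"

definition path4_free :: "('a \<Rightarrow> 'a \<Rightarrow> bool) \<Rightarrow> 'a set \<Rightarrow> bool" where
  "path4_free R X \<longleftrightarrow> \<not> (\<exists>a\<in>X. \<exists>b\<in>X. \<exists>c\<in>X. \<exists>d\<in>X. distinct [a, b, c, d] \<and>
     R a b \<and> R b c \<and> R c d \<and> \<not> R a c \<and> \<not> R a d \<and> \<not> R b d)"

lemma path4_freeD:
  "path4_free R X \<Longrightarrow> {a, b, c, d} \<subseteq> X \<Longrightarrow> distinct [a, b, c, d] \<Longrightarrow>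
    R a b \<Longrightarrow> R b c \<Longrightarrow> R c d \<Longrightarrow> \<not> R a c \<Longrightarrow> \<not> R a d \<Longrightarrow> \<not> R b d \<Longrightarrow> False"
  unfolding path4_free_def by simp blast

lemma symp_nonadj: "symp e \<Longrightarrow> symp (nonadj e)"
  unfolding nonadj_def symp_def by blast

lemma not_separated_if_linked:
  assumes "linked R X" shows "\<not> separated R X"
proof
  assume "separated R X"
  then obtain Z where "Z \<noteq> {}" "Z \<subset> X" "\<forall>a\<in>Z. \<forall>b\<in>X - Z. \<not> R a b"
    unfolding separated_def by blast
  moreover from this have "X \<inter> Z \<noteq> {}" "X - Z \<noteq> {}" by auto
  ultimately show False using assms unfolding linked_def by blast
qed

lemma separated_nonadj_nonadj: "separated (nonadj (nonadj R)) X \<longleftrightarrow> separated R X"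
proof -
  have "(\<forall>a\<in>Z. \<forall>b\<in>X - Z. \<not> nonadj (nonadj R) a b) \<longleftrightarrow> (\<forall>a\<in>Z. \<forall>b\<in>X - Z. \<not> R a b)" for Z
    unfolding nonadj_def by (metis DiffD2)
  then show ?thesis unfolding separated_def by simp
qed

lemma path4_free_nonadj:
  assumes "symp R" "path4_free R X" shows "path4_free (nonadj R) X"
  unfolding path4_free_def
proof
  assume "\<exists>a\<in>X. \<exists>b\<in>X. \<exists>c\<in>X. \<exists>d\<in>X. distinct [a, b, c, d] \<and> nonadj R a b \<and> nonadj R b c \<and>
     nonadj R c d \<and> \<not> nonadj R a c \<and> \<not> nonadj R a d \<and> \<not> nonadj R b d"
  then obtain a b c d where *: "a \<in> X" "b \<in> X" "c \<in> X" "d \<in> X" "distinct [a, b, c, d]"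
    "\<not> R a b" "\<not> R b c" "\<not> R c d" "R a c" "R a d" "R b d"
    unfolding nonadj_def by auto
  then have "distinct [b, d, a, c]" "R b d" "R d a" "R a c" "\<not> R b a" "\<not> R b c" "\<not> R d c"
    using sympD[OF assms(1)] by auto
  then show False using path4_freeD[OF assms(2), of b d a c] *(1-4) by blast
qed

text \<open>
  Suppose that \<open>R\<close> connects \<open>X \<union> {x}\<close>, but not \<open>X\<close>. Then \<open>x\<close> has neighbours in all components of \<open>X\<close>.
  Either \<open>x\<close> is related to all of \<open>X\<close>, and then the complement isolates \<open>x\<close>, or some component has
  an edge between a neighbour \<open>a\<close> and a non-neighbour \<open>b\<close> of \<open>x\<close>; then \<open>b, a, x, c\<close> is a path, for any
  neighbour \<open>c\<close> of \<open>x\<close> in another component.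
\<close>

lemma separated_insert:
  assumes sym: "symp R" and P4: "path4_free R (insert x X)"
    and x: "x \<notin> X" and sep: "separated R X"
  shows "separated R (insert x X) \<or> separated (nonadj R) (insert x X)"
proof (rule ccontr)
  assume "\<not> ?thesis"
  then have con: "\<not> separated R (insert x X)" and cocon: "\<not> separated (nonadj R) (insert x X)"
    by auto
  have "X \<noteq> {}" using sep unfolding separated_def by auto
  then have "{x} \<subset> insert x X" using x by auto
  then obtain y where y: "y \<in> X" "\<not> R x y"
    using cocon unfolding separated_def nonadj_def by (metis DiffD1 DiffD2 insertE insertI1 insert_not_empty singletonD)
  note comp = component_subset[OF sym] components_not_related[OF sym]
    linked_component[OF sym] component_nonempty[OF sym]
  have nb: "\<exists>c\<in>C. R x c" if C: "C \<in> components R X" for C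
  proof (rule ccontr)
    assume "\<not> ?thesis"
    moreover have "\<not> R a b" if "a \<in> C" "b \<in> X" "b \<notin> C" for a b
    proof -
      obtain D where "D \<in> components R X" "b \<in> D"
        using obtain_component[OF sym] \<open>b \<in> X\<close> by metis
      then show ?thesis using comp(2)[OF C, of D a b] that by auto
    qed
    ultimately have "\<forall>a\<in>C. \<forall>b\<in>insert x X - C. \<not> R a b" using sympD[OF sym] by blast
    moreover have "C \<noteq> {}" "C \<subset> insert x X" using comp(1)[OF C] comp(4)[OF C] x by auto
    ultimately show False using con unfolding separated_def by blast
  qed
  obtain A where A: "A \<in> components R X" "y \<in> A"
    using obtain_component[OF sym] y(1) by metis
  obtain c0 where c0: "c0 \<in> A" "R x c0" using nb A(1) by blast
  obtain a b where ab: "a \<in> A" "b \<in> A" "R x a" "\<not> R x b" "R a b"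
    using linkedE[OF comp(3)[OF A(1)], of c0 "R x" y] c0 A y by metis
  have "\<not> X \<subseteq> A"
  proof
    assume "X \<subseteq> A"
    then have "linked R X" using comp(1,3)[OF A(1)] by (simp add: subset_antisym)
    then show False using sep not_separated_if_linked by blast
  qed
  then obtain z where z: "z \<in> X" "z \<notin> A" by blast
  obtain C where C: "C \<in> components R X" "z \<in> C"
    using obtain_component[OF sym] z(1) by metis
  then have "C \<noteq> A" using z by auto
  obtain c where c: "c \<in> C" "R x c" using nb C(1) by blast
  have "\<not> R a c" "\<not> R b c" using comp(2)[OF A(1) C(1)] ab c \<open>C \<noteq> A\<close> by auto
  moreover have "a \<in> X" "b \<in> X" "c \<in> X" using comp(1) A C ab c by blast+
  moreover have "c \<noteq> a" "c \<noteq> b"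
    using components_eqI[OF sym A(1) C(1)] ab c \<open>C \<noteq> A\<close> by blast+
  moreover have "distinct [b, a, x, c]"
    using ab x calculation by auto
  moreover have "R b a" "R a x" "\<not> R b x" using ab sympD[OF sym] by blast+
  ultimately show False
    using path4_freeD[OF P4, of b a x c] c by simp
qed

text \<open>
  Seinsche's theorem on cographs. The induction adds one vertex at a time; as the complement
  of a path on four vertices is again such a path, one may assume that the smaller set is
  separated by \<open>R\<close> itself and not by its complement.
\<close>

lemma separated_if_path4_free:
  assumes "finite X" and sym: "symp R"
  shows "path4_free R X \<Longrightarrow> 2 \<le> card X \<Longrightarrow> separated R X \<or> separated (nonadj R) X"
  using assms(1)
proof (induction X rule: finite_induct)
  case (insert x X)
  have P4: "path4_free R X" using insert.prems unfolding path4_free_def by blast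
  show ?case
  proof (cases "2 \<le> card X")
    case True
    from insert.IH[OF P4 True] show ?thesis
    proof
      assume "separated R X"
      then show ?thesis using separated_insert[OF sym insert.prems(1) insert.hyps(2)] by blast
    next
      assume "separated (nonadj R) X"
      then show ?thesis
        using separated_insert[OF symp_nonadj[OF sym] path4_free_nonadj[OF sym insert.prems(1)] insert.hyps(2)]
        unfolding separated_nonadj_nonadj by blast
    qed
  next
    case False
    then obtain y where "X = {y}" using insert by (metis One_nat_def Suc_1 Suc_leI antisym card_1_singletonE card_insert_disjoint le_Suc_eq linorder_not_le not_less_eq_eq numeral_2_eq_2)
    moreover have "{x} \<noteq> {}" "{x} \<subset> {x, y}" "{x, y} - {x} = {y}" using insert calculation by auto
    moreover have "\<not> R x y \<or> \<not> nonadj R x y" unfolding nonadj_def by blast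
    ultimately show ?thesis unfolding separated_def by (metis singletonD)
  qed
qed simp

section \<open>Graphs critical for their clique cover number\<close>

definition stable_set :: "('a \<Rightarrow> 'a \<Rightarrow> bool) \<Rightarrow> 'a set \<Rightarrow> bool" where
  "stable_set e S \<longleftrightarrow> (\<forall>x\<in>S. \<forall>y\<in>S. \<not> e x y)"

lemma pigeonhole_class:
  assumes "finite J" "finite B" "f ` J \<subseteq> B" "card B * M < card J"
  obtains b where "b \<in> B" "M < card {i \<in> J. f i = b}"
proof (rule ccontr)
  assume "\<not> thesis"
  then have small: "card {i \<in> J. f i = b} \<le> M" if "b \<in> B" for b
    using that \<open>\<And>b. b \<in> B \<Longrightarrow> M < card {i \<in> J. f i = b} \<Longrightarrow> thesis\<close> not_le by blast
  have "J = (\<Union>b\<in>B. {i \<in> J. f i = b})" using assms(3) by auto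
  then have "card J \<le> (\<Sum>b\<in>B. card {i \<in> J. f i = b})"
    using card_UN_le[OF assms(2), of "\<lambda>b. {i \<in> J. f i = b}"] by simp
  also have "\<dots> \<le> card B * M"
    using sum_bounded_above[of B "\<lambda>b. card {i \<in> J. f i = b}" M] small by simp
  finally show False using assms(4) by simp
qed

text \<open>
  The factor \<open>(m + 2)\<^sup>2\<close> counts the possible pairs of clique cover numbers of the two halves of
  a block, and \<open>4\<^sup>m\<close> the pairs of subsets of the \<open>m\<close> colours; one more block is the deleted one.
\<close>

definition block_bound :: "nat \<Rightarrow> nat" where
  "block_bound m = (m + 2) ^ 2 * (4 ^ m + 1)"

locale cover_critical =
  fixes V :: "'a set" and e :: "'a \<Rightarrow> 'a \<Rightarrow> bool" (infix \<open>\<frown>\<close> 50) and m :: nat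
  assumes finite_V: "finite V"
    and symp_adj: "symp (\<frown>)"
    and irrefl: "\<not> x \<frown> x"
    and not_coverable: "\<not> coverable (\<frown>) V m"
    and coverable_minus: "x \<in> V \<Longrightarrow> coverable (\<frown>) (V - {x}) m"
begin

lemma sym: "x \<frown> y \<Longrightarrow> y \<frown> x"
  using sympD[OF symp_adj] .

lemma coverable_Suc: "coverable (\<frown>) V (Suc m)"
proof -
  have "V \<noteq> {}"
    using not_coverable by (auto simp: coverable_def clique_colouring_def)
  then obtain x where x: "x \<in> V" by blast
  obtain f where f: "f ` (V - {x}) \<subseteq> {..<m}" "clique_colouring (\<frown>) f (V - {x})"
    using coverable_minus[OF x] unfolding coverable_def by blast
  have "clique_colouring (\<frown>) (f(x := m)) V"
    using f unfolding clique_colouring_def by (auto simp: image_subset_iff)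
  moreover have "(f(x := m)) ` V \<subseteq> {..<Suc m}"
    using f(1) by (auto simp: image_subset_iff less_Suc_eq)
  ultimately show ?thesis unfolding coverable_def by blast
qed

lemma theta_le_Suc: "A \<subseteq> V \<Longrightarrow> theta (\<frown>) A \<le> Suc m"
  by (intro theta_le coverable_subset[OF coverable_Suc])

lemma stable_card:
  assumes "S \<subseteq> V" "stable_set (\<frown>) S" shows "card S \<le> Suc m"
proof -
  obtain f where f: "f ` V \<subseteq> {..<Suc m}" "clique_colouring (\<frown>) f V"
    using coverable_Suc unfolding coverable_def by blast
  have "inj_on f S"
    using f(2) assms unfolding clique_colouring_def stable_set_def inj_on_def by blast
  then have "card S \<le> card {..<Suc m}"
    by (rule card_inj_on_le) (use f(1) assms(1) in auto)
  then show ?thesis by simp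
qed

lemma colouring_without:
  assumes "B \<subseteq> V" "B \<noteq> {}"
  obtains c where "c ` (V - B) \<subseteq> {..<m}" "clique_colouring (\<frown>) c (V - B)"
proof -
  obtain x where x: "x \<in> B" "x \<in> V" using assms by blast
  obtain c where c: "c ` (V - {x}) \<subseteq> {..<m}" "clique_colouring (\<frown>) c (V - {x})"
    using coverable_minus[OF x(2)] unfolding coverable_def by blast
  have "V - B \<subseteq> V - {x}" using x by auto
  then show ?thesis
    using that[of c] c clique_colouring_subset by (meson image_mono subset_trans)
qed

text \<open>
  If \<open>C\<close> were deleted and the rest coloured, the colours on \<open>D\<close> would suffice for \<open>C\<close>, and they
  occur on no vertex outside that fails to be joined to \<open>C\<close>.
\<close>

lemma no_twins_le:
  assumes C: "C \<subseteq> V" "D \<subseteq> V" "C \<noteq> {}"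
    and CD: "\<And>x y. x \<in> C \<Longrightarrow> y \<in> D \<Longrightarrow> x \<frown> y"
    and out: "\<And>w x y. w \<in> V - (C \<union> D) \<Longrightarrow> x \<in> C \<Longrightarrow> y \<in> D \<Longrightarrow> w \<frown> y \<Longrightarrow> w \<frown> x"
    and le: "theta (\<frown>) C \<le> theta (\<frown>) D"
  shows False
proof -
  obtain c where c: "c ` (V - C) \<subseteq> {..<m}" "clique_colouring (\<frown>) c (V - C)"
    using colouring_without[OF C(1,3)] .
  have fin: "finite C" "finite D" using C finite_V finite_subset by blast+
  have D: "D \<subseteq> V - C" using C(2) CD irrefl by blast
  have "theta (\<frown>) D \<le> card (c ` D)"
    using clique_colouring_subset[OF c(2) D] fin by (intro theta_le_card_image)
  then have le': "theta (\<frown>) C \<le> card (c ` D)" using le by simp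
  have "theta (\<frown>) {} \<le> card ({} :: nat set)"
    using theta_le_card_image[of "(\<frown>)" _ "{}"] by (simp add: clique_colouring_def)
  have "coverable (\<frown>) V m"
  proof (rule extend_colouring[where P = C and Q = "{}" and c = c and A = "c ` D" and A' = "{}"])
    fix x w assume x: "x \<in> C" and w: "w \<in> V - (C \<union> {})" "c w \<in> c ` D"
    then obtain y where y: "y \<in> D" "c w = c y" by blast
    then have "w = y \<or> w \<frown> y" using c(2) D w unfolding clique_colouring_def by auto
    then show "x \<frown> w"
    proof (cases "w \<in> D")
      case True
      then show ?thesis using CD x by blast
    next
      case False
      then have "w \<frown> y" using \<open>w = y \<or> w \<frown> y\<close> y by auto
      then show ?thesis using out[of w x y] w(1) False x y(1) sym by auto
    qed
  next
    show "c ` D \<subseteq> {..<m}" using c(1) D by blast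
  qed (use symp_adj fin C c le' \<open>theta (\<frown>) {} \<le> card {}\<close> in auto)
  then show False using not_coverable by blast
qed

lemma no_twins:
  assumes C: "C \<subseteq> V" "D \<subseteq> V" "C \<noteq> {}" "D \<noteq> {}"
    and CD: "\<And>x y. x \<in> C \<Longrightarrow> y \<in> D \<Longrightarrow> x \<frown> y"
    and out: "\<And>w x y. w \<in> V - (C \<union> D) \<Longrightarrow> x \<in> C \<Longrightarrow> y \<in> D \<Longrightarrow> w \<frown> x \<longleftrightarrow> w \<frown> y"
  shows False
proof (cases "theta (\<frown>) C \<le> theta (\<frown>) D")
  case True
  show False using no_twins_le[OF C(1,2,3) CD _ True] out by blast
next
  case False
  have le: "theta (\<frown>) D \<le> theta (\<frown>) C" using False by simp
  show False
  proof (rule no_twins_le[OF C(2,1,4) _ _ le])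
    show "x \<frown> y" if "x \<in> D" "y \<in> C" for x y using CD sym that by blast
    show "w \<frown> x" if "w \<in> V - (D \<union> C)" "x \<in> D" "y \<in> C" "w \<frown> y" for w x y
      using out[of w y x] that by blast
  qed
qed

text \<open>
  The blocks are the pairs \<open>(P i, Q i)\<close>. After one block is deleted and the rest coloured, two
  blocks \<open>i\<close> and \<open>j\<close> with the same clique cover numbers as the deleted one agree in their colours
  on \<open>P\<close> and in their colours on \<open>Q\<close>. A colour of \<open>P i\<close> then cannot occur on any \<open>Q l\<close>: such a vertex
  is non-adjacent to \<open>P i\<close> if \<open>l \<noteq> i\<close>, and otherwise to \<open>P j\<close>, where the colour occurs as well. So
  the deleted block can be coloured like block \<open>i\<close>.
\<close>

lemma few_blocks:
  assumes J: "finite J"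
    and V: "\<And>i. i \<in> J \<Longrightarrow> P i \<subseteq> V" "\<And>i. i \<in> J \<Longrightarrow> Q i \<subseteq> V" "\<And>i. i \<in> J \<Longrightarrow> P i \<noteq> {}"
    and same: "\<And>i x y. i \<in> J \<Longrightarrow> x \<in> P i \<Longrightarrow> y \<in> Q i \<Longrightarrow> x \<frown> y"
    and PP: "\<And>i j x y. i \<in> J \<Longrightarrow> j \<in> J \<Longrightarrow> i \<noteq> j \<Longrightarrow> x \<in> P i \<Longrightarrow> y \<in> P j \<Longrightarrow> x \<frown> y"
    and QQ: "\<And>i j x y. i \<in> J \<Longrightarrow> j \<in> J \<Longrightarrow> i \<noteq> j \<Longrightarrow> x \<in> Q i \<Longrightarrow> y \<in> Q j \<Longrightarrow> x \<frown> y"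
    and PQ: "\<And>i j x y. i \<in> J \<Longrightarrow> j \<in> J \<Longrightarrow> i \<noteq> j \<Longrightarrow> x \<in> P i \<Longrightarrow> y \<in> Q j \<Longrightarrow> \<not> x \<frown> y"
    and disj: "\<And>i j. i \<in> J \<Longrightarrow> j \<in> J \<Longrightarrow> P i \<inter> Q j = {}"
    and outP: "\<And>w i j x y. w \<in> V \<Longrightarrow> w \<notin> (\<Union>i\<in>J. P i \<union> Q i) \<Longrightarrow> i \<in> J \<Longrightarrow> j \<in> J \<Longrightarrow> i \<noteq> j \<Longrightarrow>
       x \<in> P i \<Longrightarrow> y \<in> P j \<Longrightarrow> w \<frown> y \<Longrightarrow> w \<frown> x"
    and outQ: "\<And>w i j x y. w \<in> V \<Longrightarrow> w \<notin> (\<Union>i\<in>J. P i \<union> Q i) \<Longrightarrow> i \<in> J \<Longrightarrow> j \<in> J \<Longrightarrow> i \<noteq> j \<Longrightarrow>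
       x \<in> Q i \<Longrightarrow> y \<in> Q j \<Longrightarrow> w \<frown> y \<Longrightarrow> w \<frown> x"
  shows "card J \<le> block_bound m"
proof (rule ccontr)
  assume "\<not> ?thesis"
  then have big: "card ({..Suc m} \<times> {..Suc m}) * (4 ^ m + 1) < card J"
    by (simp add: block_bound_def power2_eq_square)
  define T where "T i = (theta (\<frown>) (P i), theta (\<frown>) (Q i))" for i
  have "T ` J \<subseteq> {..Suc m} \<times> {..Suc m}"
    using theta_le_Suc V by (auto simp: T_def)
  then obtain b where b: "4 ^ m + 1 < card {i \<in> J. T i = b}"
    by (rule pigeonhole_class[OF J _ _ big, rotated]) auto
  define K where "K = {i \<in> J. T i = b}"
  have K: "K \<subseteq> J" "finite K" "4 ^ m + 1 < card K" using b J unfolding K_def by auto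
  then obtain z where z: "z \<in> K" by (metis card.empty all_not_in_conv not_less_zero)
  then have zJ: "z \<in> J" using K by blast
  obtain c where c: "c ` (V - (P z \<union> Q z)) \<subseteq> {..<m}" "clique_colouring (\<frown>) c (V - (P z \<union> Q z))"
    using colouring_without[of "P z \<union> Q z"] V[OF zJ] by blast
  have Psub: "P i \<subseteq> V - (P z \<union> Q z)" if "i \<in> J" "i \<noteq> z" for i
    using V(1)[OF that(1)] PP[OF that(1) zJ that(2)] disj[OF that(1) zJ] irrefl by blast
  have Qsub: "Q i \<subseteq> V - (P z \<union> Q z)" if "i \<in> J" "i \<noteq> z" for i
    using V(2)[OF that(1)] QQ[OF that(1) zJ that(2)] disj[OF zJ that(1)] irrefl by blast
  define F where "F i = (c ` P i, c ` Q i)" for i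
  have "\<not> inj_on F (K - {z})"
  proof
    assume "inj_on F (K - {z})"
    moreover have "F ` (K - {z}) \<subseteq> Pow {..<m} \<times> Pow {..<m}"
      using c(1) Psub Qsub K(1) unfolding F_def by fast
    ultimately have "card (K - {z}) \<le> card (Pow {..<m} \<times> Pow {..<m})"
      by (intro card_inj_on_le) auto
    also have "\<dots> = 4 ^ m"
      by (simp add: card_Pow power_mult_distrib[symmetric])
    finally show False using K z by (simp add: card_Diff_singleton)
  qed
  then obtain i j where ij: "i \<in> K" "j \<in> K" "i \<noteq> z" "j \<noteq> z" "i \<noteq> j" "F i = F j"
    unfolding inj_on_def by blast
  then have iJ: "i \<in> J" "j \<in> J" using K by auto
  have thetas: "theta (\<frown>) (P z) = theta (\<frown>) (P i)" "theta (\<frown>) (Q z) = theta (\<frown>) (Q i)"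
    using ij z unfolding K_def T_def by auto
  have fin: "finite (P l)" "finite (Q l)" if "l \<in> J" for l
    using finite_subset[OF V(1)[OF that] finite_V] finite_subset[OF V(2)[OF that] finite_V] by auto
  have "coverable (\<frown>) V m"
  proof (rule extend_colouring[where P = "P z" and Q = "Q z" and c = c and A = "c ` P i" and A' = "c ` Q i"])
    show "theta (\<frown>) (P z) \<le> card (c ` P i)"
      unfolding thetas
      using theta_le_card_image[OF clique_colouring_subset[OF c(2) Psub]] iJ(1) ij(3) fin(1)[OF iJ(1)] by simp
    show "theta (\<frown>) (Q z) \<le> card (c ` Q i)"
      unfolding thetas
      using theta_le_card_image[OF clique_colouring_subset[OF c(2) Qsub]] iJ(1) ij(3) fin(2)[OF iJ(1)] by simp
    have near: "w \<in> A \<or> (\<exists>y\<in>A. w \<frown> y)"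
      if "w \<in> V - (P z \<union> Q z)" "c w \<in> c ` A" "A \<subseteq> V - (P z \<union> Q z)" for w A
      using that c(2) unfolding clique_colouring_def by blast
    have images: "c ` P j = c ` P i" "c ` Q j = c ` Q i" using ij(6) unfolding F_def by auto
    note sub = Psub[OF iJ(1) ij(3)] Psub[OF iJ(2) ij(4)] Qsub[OF iJ(1) ij(3)] Qsub[OF iJ(2) ij(4)]
    show "x \<frown> w" if x: "x \<in> P z" and w: "w \<in> V - (P z \<union> Q z)" "c w \<in> c ` P i" for x w
    proof -
      have n: "w \<in> P l \<or> (\<exists>y\<in>P l. w \<frown> y)" if "l = i \<or> l = j" for l
      proof -
        have "c w \<in> c ` P l" "P l \<subseteq> V - (P z \<union> Q z)"
          using that w(2) images sub by auto
        then show ?thesis by (rule near[OF w(1)])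
      qed
      have "x \<frown> w" if "l \<in> J" "w \<in> P l" for l
        using PP[OF zJ that(1) _ x that(2)] w(1) that(2) by blast
      moreover have "x \<frown> w" if "l \<in> J" "w \<in> Q l" for l
      proof -
        \<comment> \<open>Of the two blocks that carry the colour of \<open>w\<close>, one is not the block of \<open>w\<close>.\<close>
        obtain l' where l': "l' = i \<or> l' = j" "l' \<noteq> l" using ij(5) by blast
        then have "l' \<in> J" using iJ by blast
        then have "\<not> (\<exists>y\<in>P l'. w \<frown> y)" using PQ[OF _ that(1) l'(2)] that(2) sym by blast
        then have "w \<in> P l'" using n l'(1) by blast
        then show ?thesis using PP[OF zJ \<open>l' \<in> J\<close> _ x] w(1) by blast
      qed
      moreover have "x \<frown> w" if out: "w \<notin> (\<Union>i\<in>J. P i \<union> Q i)"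
      proof -
        obtain y where "y \<in> P i" "w \<frown> y" using n[of i] out iJ by blast
        then show ?thesis using outP[OF _ out zJ iJ(1) ij(3)[symmetric] x] w(1) sym by blast
      qed
      ultimately show ?thesis by blast
    qed
    show "x \<frown> w" if x: "x \<in> Q z" and w: "w \<in> V - (P z \<union> Q z)" "c w \<in> c ` Q i" for x w
    proof -
      have n: "w \<in> Q l \<or> (\<exists>y\<in>Q l. w \<frown> y)" if "l = i \<or> l = j" for l
      proof -
        have "c w \<in> c ` Q l" "Q l \<subseteq> V - (P z \<union> Q z)"
          using that w(2) images sub by auto
        then show ?thesis by (rule near[OF w(1)])
      qed
      have "x \<frown> w" if "l \<in> J" "w \<in> Q l" for l
        using QQ[OF zJ that(1) _ x that(2)] w(1) that(2) by blast
      moreover have "x \<frown> w" if "l \<in> J" "w \<in> P l" for l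
      proof -
        obtain l' where l': "l' = i \<or> l' = j" "l' \<noteq> l" using ij(5) by blast
        then have "l' \<in> J" using iJ by blast
        then have "\<not> (\<exists>y\<in>Q l'. w \<frown> y)" using PQ[OF that(1)] l'(2) that(2) sym by blast
        then have "w \<in> Q l'" using n l'(1) by blast
        then show ?thesis using QQ[OF zJ \<open>l' \<in> J\<close> _ x] w(1) by blast
      qed
      moreover have "x \<frown> w" if out: "w \<notin> (\<Union>i\<in>J. P i \<union> Q i)"
      proof -
        obtain y where "y \<in> Q i" "w \<frown> y" using n[of i] out iJ by blast
        then show ?thesis using outQ[OF _ out zJ iJ(1) ij(3)[symmetric] x] w(1) sym by blast
      qed
      ultimately show ?thesis by blast
    qed
    show "c ` P i \<subseteq> {..<m}" "c ` Q i \<subseteq> {..<m}" using c(1) sub by blast+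
    show "symp (\<frown>)" by (rule symp_adj)
    show "x \<frown> y" if "x \<in> P z" "y \<in> Q z" for x y using same[OF zJ that] .
  qed (use fin[OF zJ] fin[OF iJ(1)] V(1,2)[OF zJ] c in auto)
  then show False using not_coverable by blast
qed

end

section \<open>Neighbourhoods in a critical (P5, gem)-free graph\<close>

locale P5_gem_free_critical = cover_critical +
  assumes no_P5: "a \<frown> b \<Longrightarrow> b \<frown> c \<Longrightarrow> c \<frown> d \<Longrightarrow> d \<frown> f \<Longrightarrow>
      \<not> a \<frown> c \<Longrightarrow> \<not> a \<frown> d \<Longrightarrow> \<not> a \<frown> f \<Longrightarrow> \<not> b \<frown> d \<Longrightarrow> \<not> b \<frown> f \<Longrightarrow> \<not> c \<frown> f \<Longrightarrow> False"
    and no_gem: "w \<frown> a \<Longrightarrow> w \<frown> b \<Longrightarrow> w \<frown> c \<Longrightarrow> w \<frown> d \<Longrightarrow> a \<frown> b \<Longrightarrow> b \<frown> c \<Longrightarrow> c \<frown> d \<Longrightarrow>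
      \<not> a \<frown> c \<Longrightarrow> \<not> a \<frown> d \<Longrightarrow> \<not> b \<frown> d \<Longrightarrow> False"
begin

definition mixed :: "'a \<Rightarrow> 'a set \<Rightarrow> bool" where
  "mixed u A \<longleftrightarrow> (\<exists>a\<in>A. u \<frown> a) \<and> (\<exists>b\<in>A. \<not> u \<frown> b)"

definition far :: "'a \<Rightarrow> 'a set" where
  "far v = {u \<in> V. u \<noteq> v \<and> \<not> v \<frown> u}"

text \<open>
  The parts of \<open>N(v)\<close> produced by the repeated splitting: a vertex of \<open>N(v) - Y\<close> is joined to none
  or to all of \<open>Y\<close>. In the latter case it is also non-adjacent to the non-neighbours \<open>u\<close> of \<open>v\<close> that
  distinguish vertices of \<open>Y\<close>. The reason is a gem (\<open>mixed_avoids\<close>) through a non-adjacent pair of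
  a larger component containing \<open>Y\<close>. As \<open>Y\<close> itself need not contain such a pair, the property has
  to be passed down from one splitting to the next.
\<close>

definition node :: "'a \<Rightarrow> 'a set \<Rightarrow> bool" where
  "node v Y \<longleftrightarrow> v \<in> V \<and> Y \<subseteq> {x \<in> V. v \<frown> x} \<and>
     (\<forall>w\<in>V. v \<frown> w \<longrightarrow> w \<notin> Y \<longrightarrow>
        (\<forall>y\<in>Y. \<not> w \<frown> y) \<or>
        ((\<forall>y\<in>Y. w \<frown> y) \<and> (\<forall>u\<in>far v. mixed u Y \<longrightarrow> \<not> u \<frown> w)))"

text \<open>
  Otherwise \<open>w\<close> is the centre of a gem over the path \<open>u, a, v, b\<close>.
\<close>

lemma mixed_avoids:
  assumes "v \<frown> a" "v \<frown> b" "v \<frown> w" "\<not> v \<frown> u" "nonadj (\<frown>) a b" "u \<frown> a" "\<not> u \<frown> b" "w \<frown> a" "w \<frown> b"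
  shows "\<not> u \<frown> w"
proof
  assume "u \<frown> w"
  then show False
    using no_gem[of w u a v b] assms sym unfolding nonadj_def by blast
qed

text \<open>
  Otherwise \<open>c\<close> is the centre of a gem over the path \<open>u', u, d, v\<close>.
\<close>

lemma adjacent_traces:
  assumes "\<not> v \<frown> u" "\<not> v \<frown> u'" "v \<frown> c" "v \<frown> d" "c \<frown> d" "u \<frown> u'" "u \<frown> c" "u' \<frown> c" "u \<frown> d"
  shows "u' \<frown> d"
proof (rule ccontr)
  assume "\<not> u' \<frown> d"
  then show False
    using no_gem[of c u' u d v] assms sym by blast
qed

text \<open>
  Otherwise \<open>c\<close> is the centre of a gem over the path \<open>u, a, b, u'\<close>, unless \<open>u\<close> and \<open>u'\<close> are adjacent;
  in that case \<open>adjacent_traces\<close> gives a gem already without \<open>b\<close>.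
\<close>

lemma crossing_traces:
  assumes "\<not> v \<frown> u" "\<not> v \<frown> u'" "v \<frown> c" "v \<frown> a" "v \<frown> b" "c \<frown> a" "c \<frown> b" "a \<frown> b"
    "u \<frown> c" "u' \<frown> c" "u \<frown> a" "u' \<frown> b"
  shows "u \<frown> b \<or> u' \<frown> a"
proof (cases "u \<frown> u'")
  case True
  then show ?thesis using adjacent_traces[of v u u' c a] assms by blast
next
  case False
  then show ?thesis using no_gem[of c u a b u'] assms sym by blast
qed

text \<open>
  Otherwise \<open>d, w, u, c, v\<close> is an induced path.
\<close>

lemma middle_trace:
  assumes "\<not> v \<frown> d" "\<not> v \<frown> w" "\<not> v \<frown> u" "v \<frown> c" "\<not> d \<frown> u" "w \<frown> d" "w \<frown> u" "u \<frown> c"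
  shows "c \<frown> d \<or> c \<frown> w"
  using no_P5[of d w u c v] assms sym by blast

end

locale neighbourhood_node = P5_gem_free_critical +
  fixes v :: 'a and Y :: "'a set"
  assumes is_node: "node v Y"
begin

lemma v_in_V: "v \<in> V" and Y_sub: "y \<in> Y \<Longrightarrow> y \<in> V" and v_adj: "y \<in> Y \<Longrightarrow> v \<frown> y"
  using is_node unfolding node_def by auto

text \<open>
  Distinct components are completely joined in \<open>\<frown>\<close>, since they are components of non-adjacency.
\<close>

definition comps :: "'a set set" where
  "comps = components (nonadj (\<frown>)) Y"

definition trace :: "'a \<Rightarrow> 'a set set" where
  "trace u = {C \<in> comps. \<exists>c\<in>C. u \<frown> c}"

lemma farD: "u \<in> far v \<Longrightarrow> u \<in> V" "u \<in> far v \<Longrightarrow> \<not> v \<frown> u" "u \<in> far v \<Longrightarrow> \<not> u \<frown> v" "u \<in> far v \<Longrightarrow> u \<noteq> v"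
  unfolding far_def using sym by auto

lemma finite_Y: "finite Y"
  using finite_V Y_sub by (meson finite_subset subsetI)

lemmas symp_non = symp_nonadj[OF symp_adj]

lemma finite_comps: "finite comps"
  unfolding comps_def by (rule finite_components[OF symp_non finite_Y])

lemma comp_sub: "C \<in> comps \<Longrightarrow> c \<in> C \<Longrightarrow> c \<in> Y"
  using component_subset[OF symp_non] unfolding comps_def by blast

lemma comp_nonempty: "C \<in> comps \<Longrightarrow> C \<noteq> {}"
  using component_nonempty[OF symp_non] unfolding comps_def by blast

lemma comp_eqI: "C \<in> comps \<Longrightarrow> D \<in> comps \<Longrightarrow> x \<in> C \<Longrightarrow> x \<in> D \<Longrightarrow> C = D"
  using components_eqI[OF symp_non] unfolding comps_def by blast

lemma comp_obtain: assumes "y \<in> Y" obtains C where "C \<in> comps" "y \<in> C"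
  using obtain_component[OF symp_non assms] unfolding comps_def by blast

lemma comps_complete:
  assumes "C \<in> comps" "D \<in> comps" "C \<noteq> D" "c \<in> C" "d \<in> D"
  shows "c \<frown> d"
  using components_not_related[OF symp_non] comp_eqI assms unfolding comps_def nonadj_def by blast

lemma comp_adj: "C \<in> comps \<Longrightarrow> c \<in> C \<Longrightarrow> v \<frown> c"
  using comp_sub v_adj by blast

lemma traceI: "C \<in> comps \<Longrightarrow> c \<in> C \<Longrightarrow> u \<frown> c \<Longrightarrow> C \<in> trace u"
  unfolding trace_def by blast

lemma traceE: assumes "C \<in> trace u" obtains c where "C \<in> comps" "c \<in> C" "u \<frown> c"
  using assms unfolding trace_def by blast

lemma trace_comps: "trace u \<subseteq> comps"
  unfolding trace_def by blast

lemma mixed_edge: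
  assumes "C \<in> comps" "mixed u C"
  obtains a b where "a \<in> C" "b \<in> C" "u \<frown> a" "\<not> u \<frown> b" "nonadj (\<frown>) a b"
proof -
  have "linked (nonadj (\<frown>)) C"
    using linked_component[OF symp_non] assms(1) unfolding comps_def by blast
  moreover obtain a0 b0 where "a0 \<in> C" "u \<frown> a0" "b0 \<in> C" "\<not> u \<frown> b0"
    using assms(2) unfolding mixed_def by blast
  ultimately show ?thesis
    using that by (rule linkedE[where P = "\<lambda>x. u \<frown> x"])
qed

text \<open>
  Some non-edge of \<open>C\<close> separates neighbours of \<open>u\<close> from non-neighbours, while all vertices of the
  other components are joined to both of its ends, so \<open>mixed_avoids\<close> applies to them.
\<close>

lemma mixed_trace:
  assumes u: "u \<in> far v" and C: "C \<in> comps" and mix: "mixed u C"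
  shows "trace u = {C}"
proof -
  obtain a b where ab: "a \<in> C" "b \<in> C" "u \<frown> a" "\<not> u \<frown> b" "nonadj (\<frown>) a b"
    using mixed_edge[OF C mix] .
  have "D = C" if D: "D \<in> trace u" for D
  proof (rule ccontr)
    assume "D \<noteq> C"
    obtain d where d: "D \<in> comps" "d \<in> D" "u \<frown> d" using D by (rule traceE)
    have "\<not> u \<frown> d"
      using mixed_avoids[of v a b d u] ab d comp_adj[OF C] comp_adj[OF d(1)] farD(2)[OF u]
        comps_complete[OF d(1) C \<open>D \<noteq> C\<close> d(2)] by blast
    then show False using d by blast
  qed
  moreover have "C \<in> trace u" using traceI[OF C ab(1,3)] .
  ultimately show ?thesis by blast
qed

lemma trace_complete:
  assumes "u \<in> far v" "C \<in> trace u" "trace u \<noteq> {C}" "c \<in> C"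
  shows "u \<frown> c"
proof (rule ccontr)
  assume "\<not> u \<frown> c"
  moreover obtain d where "C \<in> comps" "d \<in> C" "u \<frown> d" using assms(2) by (rule traceE)
  ultimately have "mixed u C" using assms(4) unfolding mixed_def by blast
  then show False using mixed_trace[OF assms(1) \<open>C \<in> comps\<close>] assms(3) by blast
qed

lemma trace_laminar:
  assumes u: "u \<in> far v" "u' \<in> far v" and meet: "trace u \<inter> trace u' \<noteq> {}"
  shows "trace u \<subseteq> trace u' \<or> trace u' \<subseteq> trace u"
proof (rule ccontr)
  assume "\<not> ?thesis"
  then obtain A B where A: "A \<in> trace u" "A \<notin> trace u'" and B: "B \<in> trace u'" "B \<notin> trace u"
    by blast
  obtain C where C: "C \<in> trace u" "C \<in> trace u'" using meet by blast
  have comps: "A \<in> comps" "B \<in> comps" "C \<in> comps" using A B C trace_comps by blast+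
  have ne: "A \<noteq> B" "A \<noteq> C" "B \<noteq> C" using A B C by blast+
  have "trace u \<noteq> {C}" "trace u' \<noteq> {C}" using A B ne by blast+
  then have all: "\<forall>c\<in>C. u \<frown> c" "\<forall>c\<in>C. u' \<frown> c"
    using trace_complete u C by blast+
  obtain a b c where a: "a \<in> A" "u \<frown> a" and b: "b \<in> B" "u' \<frown> b" and c: "c \<in> C"
    using A(1) B(1) comp_nonempty[OF comps(3)] unfolding trace_def by blast
  have "\<not> u \<frown> b" "\<not> u' \<frown> a"
    using traceI[OF comps(2) b(1)] traceI[OF comps(1) a(1)] A(2) B(2) by auto
  moreover have "c \<frown> a" "c \<frown> b" "a \<frown> b"
    using comps_complete comps ne a b c by metis+
  ultimately show False
    using crossing_traces[of v u u' c a b] all a b c comp_adj comps farD(2)[OF u(1)] farD(2)[OF u(2)] by blast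
qed

text \<open>
  This limits the length of chains of traces, because stable sets have at most \<open>m + 1\<close> vertices.
\<close>

lemma nested_nonadjacent:
  assumes u: "u \<in> far v" "u' \<in> far v" and nest: "trace u' \<noteq> {}" "trace u' \<subset> trace u"
  shows "\<not> u \<frown> u'"
proof
  assume adj: "u \<frown> u'"
  obtain C where C: "C \<in> trace u'" using nest by blast
  obtain A where A: "A \<in> trace u" "A \<notin> trace u'" using nest by blast
  obtain c where c: "C \<in> comps" "c \<in> C" "u' \<frown> c" using C by (rule traceE)
  obtain a where a: "A \<in> comps" "a \<in> A" "u \<frown> a" using A(1) by (rule traceE)
  have "A \<noteq> C" using A C by blast
  then have "u \<frown> c" using trace_complete[OF u(1), of C c] A C nest c by blast
  moreover have "c \<frown> a" using comps_complete a c \<open>A \<noteq> C\<close> by metis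
  moreover have "\<not> u' \<frown> a" using A(2) traceI a by blast
  ultimately show False
    using adjacent_traces[of v u u' c a] adj a c comp_adj farD(2)[OF u(1)] farD(2)[OF u(2)] by blast
qed

text \<open>
  With non-adjacent \<open>a, b \<in> C\<close> such that \<open>u\<close> sees only \<open>a\<close>, and \<open>d \<in> C'\<close> not seen by \<open>u'\<close>, an edge
  between \<open>u\<close> and \<open>u'\<close> would complete the induced path \<open>u', u, a, d, b\<close>.
\<close>

lemma mixed_nonadjacent:
  assumes u: "u \<in> far v" "u' \<in> far v" and C: "C \<in> comps" "C' \<in> comps" "C \<noteq> C'"
    and mix: "mixed u C" "mixed u' C'"
  shows "\<not> u \<frown> u'"
proof
  assume adj: "u \<frown> u'"
  obtain a b where ab: "a \<in> C" "b \<in> C" "u \<frown> a" "\<not> u \<frown> b" "nonadj (\<frown>) a b"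
    using mixed_edge[OF C(1) mix(1)] .
  obtain d where d: "d \<in> C'" "\<not> u' \<frown> d" using mix(2) unfolding mixed_def by blast
  have "C' \<notin> trace u" "C \<notin> trace u'"
    using mixed_trace[OF u(1) C(1) mix(1)] mixed_trace[OF u(2) C(2) mix(2)] C(3) by auto
  then have "\<not> u \<frown> d" "\<not> u' \<frown> a" "\<not> u' \<frown> b"
    using traceI[OF C(2) d(1)] traceI[OF C(1) ab(1)] traceI[OF C(1) ab(2)] by auto
  moreover have "a \<frown> d" "d \<frown> b" using comps_complete C ab d by metis+
  moreover have "\<not> a \<frown> b" using ab(5) unfolding nonadj_def by blast
  ultimately show False
    using no_P5[of u' u a d b] adj ab d sym by blast
qed

text \<open>
  Otherwise \<open>C\<close> and \<open>C'\<close> are twins: \<open>v\<close> and the remaining components of \<open>Y\<close> are joined to both, the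
  other neighbours of \<open>v\<close> do not distinguish vertices of the node, and a vertex mixed on one of
  the two would separate them, as its trace would be a singleton.
\<close>

lemma comps_separated:
  assumes C: "C \<in> comps" "C' \<in> comps" "C \<noteq> C'"
  obtains u where "u \<in> far v" "C \<in> trace u \<longleftrightarrow> C' \<notin> trace u"
proof (rule ccontr)
  assume "\<not> thesis"
  then have same: "C \<in> trace u \<longleftrightarrow> C' \<in> trace u" if "u \<in> far v" for u
    using that \<open>\<And>u. u \<in> far v \<Longrightarrow> (C \<in> trace u) = (C' \<notin> trace u) \<Longrightarrow> thesis\<close> by blast
  have "w \<frown> x \<longleftrightarrow> w \<frown> y" if w: "w \<in> V - (C \<union> C')" and x: "x \<in> C" and y: "y \<in> C'" for w x y
  proof -
    have xy: "x \<in> Y" "y \<in> Y" using C x y comp_sub by blast+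
    consider "w = v" | "w \<in> far v" | "w \<in> Y" | "v \<frown> w" "w \<notin> Y" using w unfolding far_def by blast
    then show ?thesis
    proof cases
      case 1
      then show ?thesis using xy v_adj by blast
    next
      case 2
      have "trace w \<noteq> {C}" "trace w \<noteq> {C'}" using same[OF 2] C(3) by blast+
      then have "w \<frown> x \<longleftrightarrow> C \<in> trace w" "w \<frown> y \<longleftrightarrow> C' \<in> trace w"
        using trace_complete[OF 2] traceI C x y by blast+
      then show ?thesis using same[OF 2] by blast
    next
      case 3
      then obtain D where D: "D \<in> comps" "w \<in> D" by (rule comp_obtain)
      then have "D \<noteq> C" "D \<noteq> C'" using w by blast+
      then show ?thesis using comps_complete[OF D(1) C(1) _ D(2) x] comps_complete[OF D(1) C(2) _ D(2) y] by blast
    next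
      case 4
      then show ?thesis using is_node w xy unfolding node_def by blast
    qed
  qed
  moreover have "C \<subseteq> V" "C' \<subseteq> V" using C comp_sub Y_sub by blast+
  ultimately show False
    using no_twins[of C C', OF _ _ comp_nonempty[OF C(1)] comp_nonempty[OF C(2)] comps_complete[OF C]]
    by blast
qed

end

section \<open>Bounding the number of components of a node\<close>

text \<open>
  The recursion for laminar families: at most one element of a set lies in none of its at most
  \<open>b\<close> maximal proper subsets, and these have height \<open>n\<close>.
\<close>

primrec chain_bound :: "nat \<Rightarrow> nat \<Rightarrow> nat" where
  "chain_bound b 0 = 1"
| "chain_bound b (Suc n) = 1 + b * chain_bound b n"

context neighbourhood_node
begin

text \<open>
  The children of \<open>S\<close> in the tree of traces.
\<close>

definition branches :: "'a set set \<Rightarrow> 'a set set set" where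
  "branches S = {J \<in> trace ` far v. J \<noteq> {} \<and> J \<subset> S \<and> (\<forall>K\<in>trace ` far v. J \<subset> K \<longrightarrow> \<not> K \<subset> S)}"

text \<open>
  The vertices whose traces lie in the subtree below \<open>J\<close>, including those mixed on a component
  in \<open>J\<close>.
\<close>

definition inside :: "'a set set \<Rightarrow> 'a set" where
  "inside J = {u \<in> far v. trace u \<noteq> {} \<and> trace u \<subseteq> J}"

text \<open>
  Consequently three vertices with pairwise disjoint nonempty traces span a triangle or a
  stable set. If \<open>z\<close> is adjacent to \<open>y\<close> only, then \<open>x, y, z, c, v\<close> is an induced path for a
  neighbour \<open>c\<close> of \<open>z\<close> in the node; if it is adjacent to neither, then \<open>y, x, a, c, z\<close> is one.
\<close>

lemma disjoint_traces_triple: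
  assumes far: "x \<in> far v" "y \<in> far v" "z \<in> far v" and z: "trace z \<noteq> {}" and x: "trace x \<noteq> {}"
    and disj: "trace x \<inter> trace y = {}" "trace x \<inter> trace z = {}" "trace y \<inter> trace z = {}"
    and adj: "x \<frown> y"
  shows "x \<frown> z"
proof (rule ccontr)
  assume non: "\<not> x \<frown> z"
  obtain C where C: "C \<in> trace z" using z by blast
  obtain c where c: "C \<in> comps" "c \<in> C" "z \<frown> c" using C by (rule traceE)
  have cn: "\<not> x \<frown> c" "\<not> y \<frown> c" using traceI[OF c(1,2)] C disj by blast+
  show False
  proof (cases "y \<frown> z")
    case True
    then show False
      using middle_trace[of v x y z c] non adj cn c comp_adj[OF c(1,2)] farD(2)[OF far(1)] farD(2)[OF far(2)]
        farD(2)[OF far(3)] sym by blast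
  next
    case False
    obtain A where A: "A \<in> trace x" using x by blast
    obtain a where a: "A \<in> comps" "a \<in> A" "x \<frown> a" using A by (rule traceE)
    have "\<not> y \<frown> a" "\<not> z \<frown> a" using traceI[OF a(1,2)] A disj by blast+
    moreover have "a \<frown> c"
      using comps_complete[OF a(1) c(1) _ a(2) c(2)] A C disj(2) by blast
    ultimately show False
      using no_P5[of y x a c z] a c cn non False adj sym by blast
  qed
qed

lemma branchE:
  assumes "J \<in> branches S"
  obtains u where "u \<in> far v" "trace u = J" "u \<in> inside J"
  using assms unfolding branches_def inside_def by blast

lemma branch_trace: "J \<in> branches S \<Longrightarrow> J \<in> trace ` far v \<and> J \<noteq> {} \<and> J \<subset> S"
  unfolding branches_def by blast

lemma branch_maximal: "J \<in> branches S \<Longrightarrow> K \<in> trace ` far v \<Longrightarrow> J \<subset> K \<Longrightarrow> \<not> K \<subset> S"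
  unfolding branches_def by blast

lemma branches_disjoint:
  assumes J: "J \<in> branches S" and K: "K \<in> branches S" and "J \<noteq> K"
  shows "J \<inter> K = {}"
proof (rule ccontr)
  assume meet: "J \<inter> K \<noteq> {}"
  obtain u where u: "u \<in> far v" "trace u = J" using branchE[OF J] .
  obtain w where w: "w \<in> far v" "trace w = K" using branchE[OF K] .
  have "J \<subseteq> K \<or> K \<subseteq> J" using trace_laminar[OF u(1) w(1)] u(2) w(2) meet by simp
  then have "J \<subset> K \<or> K \<subset> J" using \<open>J \<noteq> K\<close> by blast
  then show False
    using branch_maximal[OF J] branch_maximal[OF K] branch_trace[OF J] branch_trace[OF K] by blast
qed

lemma finite_branches: "finite (branches S)"
proof -
  have "branches S \<subseteq> trace ` V" unfolding branches_def far_def by blast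
  then show ?thesis using finite_V by (meson finite_imageI finite_subset)
qed

lemma inside_triple:
  assumes J: "J \<in> branches S" "K \<in> branches S" "L \<in> branches S" "J \<noteq> K" "J \<noteq> L" "K \<noteq> L"
    and xyz: "x \<in> inside J" "y \<in> inside K" "z \<in> inside L" "x \<frown> y"
  shows "x \<frown> z"
proof -
  have "J \<inter> K = {}" "J \<inter> L = {}" "K \<inter> L = {}" using branches_disjoint J by blast+
  then have "trace x \<inter> trace y = {}" "trace x \<inter> trace z = {}" "trace y \<inter> trace z = {}"
    using xyz unfolding inside_def by blast+
  then show ?thesis
    using disjoint_traces_triple[of x y z] xyz unfolding inside_def by blast
qed

text \<open>
  More than \<open>m + 1\<close> vertices with distinct branches as traces contain an edge, say between the
  representatives of the branches \<open>A\<close> and \<open>B\<close>. A third branch is then joined to both, by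
  \<open>disjoint_traces_triple\<close>, and the adjacency spreads from triple to triple. At least three
  branches are needed to reach the pair \<open>A, B\<close> itself.
\<close>

lemma inside_complete:
  assumes many: "m + 3 \<le> card (branches S)"
    and J: "J \<in> branches S" and K: "K \<in> branches S" and "J \<noteq> K"
    and x: "x \<in> inside J" and y: "y \<in> inside K"
  shows "x \<frown> y"
proof -
  have "\<forall>J\<in>branches S. \<exists>u. u \<in> inside J \<and> trace u = J"
    using branchE by metis
  then obtain r where r: "\<And>J. J \<in> branches S \<Longrightarrow> r J \<in> inside J" "\<And>J. J \<in> branches S \<Longrightarrow> trace (r J) = J"
    by metis
  have "inj_on r (branches S)" using r(2) by (metis inj_onI)
  then have "m + 3 \<le> card (r ` branches S)" using many by (simp add: card_image)
  moreover have "r ` branches S \<subseteq> V" using r(1) unfolding inside_def far_def by blast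
  ultimately have "\<not> stable_set (\<frown>) (r ` branches S)" using stable_card[of "r ` branches S"] by linarith
  then obtain A B where AB: "A \<in> branches S" "B \<in> branches S" "r A \<frown> r B"
    unfolding stable_set_def by blast
  then have "A \<noteq> B" using irrefl by blast
  have key: "x \<frown> y" if J: "J \<in> branches S" "K \<in> branches S" "J \<noteq> K" "J \<noteq> A" "J \<noteq> B"
    and x: "x \<in> inside J" "y \<in> inside K" for J K x y
  proof -
    have "r A \<frown> x" "r B \<frown> x"
      using inside_triple[OF AB(1,2) J(1) \<open>A \<noteq> B\<close>] inside_triple[OF AB(2,1) J(1) \<open>A \<noteq> B\<close>[symmetric]]
        r(1)[OF AB(1)] r(1)[OF AB(2)] AB(3) sym[OF AB(3)] J x(1) by auto
    then have "x \<frown> r A" "x \<frown> r B" using sym by blast+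
    moreover have "x \<frown> y" if "L \<in> branches S" "L \<noteq> J" "L \<noteq> K" "x \<frown> r L" for L
      using inside_triple[OF J(1) that(1) J(2) that(2)[symmetric] J(3) that(3) x(1) r(1)[OF that(1)] x(2) that(4)] .
    ultimately show ?thesis using AB(1,2) \<open>A \<noteq> B\<close> J by metis
  qed
  show ?thesis
  proof (cases "J \<in> {A, B} \<and> K \<in> {A, B}")
    case False
    then consider "J \<noteq> A" "J \<noteq> B" | "K \<noteq> A" "K \<noteq> B" by blast
    then show ?thesis
    proof cases
      case 1 then show ?thesis using key J K x y \<open>J \<noteq> K\<close> by blast
    next
      case 2 then show ?thesis using key[of K J y x] J K x y \<open>J \<noteq> K\<close> sym by blast
    qed
  next
    case True
    have "card {A, B} \<le> 2" by (simp add: card_insert_if)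
    then have "card {A, B} < card (branches S)" using many by linarith
    then have "\<not> branches S \<subseteq> {A, B}" by (meson card_mono finite.emptyI finite.insertI leD)
    then obtain L where L: "L \<in> branches S" "L \<noteq> A" "L \<noteq> B" by blast
    have "J \<noteq> L" "K \<noteq> L" using True L by auto
    have "r L \<frown> x" using key[OF L(1) J _ L(2,3) r(1)[OF L(1)] x] \<open>J \<noteq> L\<close> by blast
    then show ?thesis
      using inside_triple[OF J L(1) K \<open>J \<noteq> L\<close> \<open>J \<noteq> K\<close> \<open>K \<noteq> L\<close>[symmetric] x r(1)[OF L(1)] y] sym by blast
  qed
qed

text \<open>
  A vertex \<open>x\<close> with smaller trace is not adjacent to a vertex \<open>u\<close> whose trace is \<open>J\<close>, yet both are
  adjacent to a vertex \<open>w\<close> belonging to another branch. Then \<open>middle_trace\<close> puts every component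
  in \<open>J\<close> into the trace of \<open>x\<close> or of \<open>w\<close>, although the latter is disjoint from \<open>J\<close>.
\<close>

lemma inside_trace:
  assumes many: "m + 3 \<le> card (branches S)" and J: "J \<in> branches S" and x: "x \<in> inside J"
  shows "trace x = J"
proof (rule ccontr)
  assume "trace x \<noteq> J"
  then have sub: "trace x \<noteq> {}" "trace x \<subset> J" "x \<in> far v" using x unfolding inside_def by auto
  obtain u where u: "u \<in> far v" "trace u = J" "u \<in> inside J" using branchE[OF J] .
  have "card {J} < card (branches S)" using many by simp
  then have "\<not> branches S \<subseteq> {J}" by (meson card_mono finite.emptyI finite.insertI leD)
  then obtain K where K: "K \<in> branches S" "J \<noteq> K" by blast
  obtain w where w: "w \<in> far v" "trace w = K" "w \<in> inside K" using branchE[OF K(1)] .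
  have adj: "w \<frown> x" "w \<frown> u"
    using inside_complete[OF many K(1) J K(2)[symmetric] w(3)] x u(3) by blast+
  have "\<not> u \<frown> x" using nested_nonadjacent[OF u(1) sub(3,1)] sub(2) u(2) by blast
  then have non: "\<not> x \<frown> u" using sym by blast
  obtain C where C: "C \<in> trace u" "C \<notin> trace x" using sub u by blast
  obtain c where c: "C \<in> comps" "c \<in> C" "u \<frown> c" using C(1) by (rule traceE)
  have "C \<notin> trace w" using branches_disjoint[OF J K(1,2)] C(1) u w by blast
  then have "\<not> x \<frown> c" "\<not> w \<frown> c" using traceI[OF c(1,2)] C by blast+
  then show False
    using middle_trace[of v x w u c] adj non c(3) comp_adj[OF c(1,2)] farD(2)[OF u(1)] farD(2)[OF w(1)]
      farD(2)[OF sub(3)] sym by blast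
qed

text \<open>
  A vertex that separates two components of \<open>J\<close> has, by laminarity, a trace properly inside \<open>J\<close>.
\<close>

lemma branch_singleton:
  assumes S: "S = comps \<or> S \<in> trace ` far v"
    and many: "m + 3 \<le> card (branches S)" and J: "J \<in> branches S"
  obtains C where "C \<in> comps" "J = {C}"
proof -
  obtain u where u: "u \<in> far v" "trace u = J" "u \<in> inside J" using branchE[OF J] .
  obtain C where C: "C \<in> J" using J unfolding branches_def by blast
  have "D = C" if D: "D \<in> J" for D
  proof (rule ccontr)
    assume "D \<noteq> C"
    have comps: "C \<in> comps" "D \<in> comps" using C D u trace_comps by blast+
    obtain w where w: "w \<in> far v" "C \<in> trace w \<longleftrightarrow> D \<notin> trace w"
      using comps_separated[OF comps \<open>D \<noteq> C\<close>[symmetric]] .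
    then have "trace w \<inter> trace u \<noteq> {}" "\<not> trace u \<subseteq> trace w" using C D u(2) by blast+
    then have "trace w \<subseteq> J" "trace w \<noteq> {}" using trace_laminar[OF w(1) u(1)] u(2) by blast+
    then have "trace w = J" using inside_trace[OF many J] w(1) unfolding inside_def by blast
    then show False using w(2) C D by blast
  qed
  then have "J = {C}" using C by blast
  moreover have "C \<in> comps" using C u trace_comps by blast
  ultimately show ?thesis using that by blast
qed

text \<open>
  With many branches, the components \<open>C\<close> that form a branch, paired with the set \<open>Q C\<close> of vertices
  with trace \<open>{C}\<close>, satisfy the hypotheses of \<open>few_blocks\<close>. One branch may have to be discarded,
  because \<open>Q C\<close> is not joined to \<open>C\<close> if some vertex is mixed on \<open>C\<close>. A vertex outside the blocks
  that has some \<open>C\<close> in its trace has all of \<open>S\<close> in it, by maximality of the branches, and sees no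
  \<open>Q C\<close>. If its trace avoids the blocks, or if it is a neighbour of \<open>v\<close> not joined to the node, it
  sees all or none of the vertices in the sets \<open>Q C\<close>, as \<open>P\<^sub>5\<close> is excluded.
\<close>

lemma few_branches:
  assumes S: "S = comps \<or> S \<in> trace ` far v"
  shows "card (branches S) \<le> block_bound m + m + 3"
proof (rule ccontr)
  assume "\<not> ?thesis"
  then have big: "block_bound m + m + 3 < card (branches S)" by simp
  then have many: "m + 3 \<le> card (branches S)" by simp
  define bad where "bad = {J \<in> branches S. \<exists>C u. J = {C} \<and> u \<in> far v \<and> mixed u C}"
  define G where "G = {C \<in> comps. {C} \<in> branches S - bad}"
  define Q where "Q C = {u \<in> far v. trace u = {C}}" for C
  have Q_inside: "Q C \<subseteq> inside {C}" for C unfolding Q_def inside_def by blast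
  have QQ: "x \<frown> y" if "C \<in> G" "D \<in> G" "C \<noteq> D" "x \<in> Q C" "y \<in> Q D" for C D x y
    using inside_complete[OF many, of "{C}" "{D}" x y] that Q_inside unfolding G_def by blast
  \<comment> \<open>Vertices mixed on two different branches would be non-adjacent by \<open>mixed_nonadjacent\<close>, but
     vertices of different branches are adjacent.\<close>
  have "J = K" if J: "J \<in> bad" and K: "K \<in> bad" for J K
  proof (rule ccontr)
    assume "J \<noteq> K"
    obtain C u where u: "J = {C}" "u \<in> far v" "mixed u C" using J unfolding bad_def by blast
    obtain D w where w: "K = {D}" "w \<in> far v" "mixed w D" using K unfolding bad_def by blast
    have JK: "J \<in> branches S" "K \<in> branches S" using J K unfolding bad_def by auto
    have "C \<in> comps" "D \<in> comps" using branchE[OF JK(1)] branchE[OF JK(2)] u(1) w(1) trace_comps by (metis insert_subset)+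
    then have "\<not> u \<frown> w" using mixed_nonadjacent u w \<open>J \<noteq> K\<close> by blast
    moreover have "u \<in> inside J" "w \<in> inside K"
      using mixed_trace[OF u(2) \<open>C \<in> comps\<close> u(3)] mixed_trace[OF w(2) \<open>D \<in> comps\<close> w(3)] u w
      unfolding inside_def by blast+
    ultimately show False using inside_complete[OF many JK \<open>J \<noteq> K\<close>] by blast
  qed
  then have card_bad: "card bad \<le> 1"
    by (metis card_le_Suc0_iff_eq One_nat_def card.infinite le_0_eq nat_le_linear)
  have "branches S \<subseteq> (\<lambda>C. {C}) ` G \<union> bad"
  proof
    fix J assume J: "J \<in> branches S"
    obtain C where "C \<in> comps" "J = {C}" using branch_singleton[OF S many J] .
    then show "J \<in> (\<lambda>C. {C}) ` G \<union> bad" using J unfolding G_def by blast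
  qed
  moreover have finG: "finite G" using finite_comps unfolding G_def by simp
  moreover have "finite bad" using finite_branches unfolding bad_def by simp
  ultimately have "card (branches S) \<le> card ((\<lambda>C. {C}) ` G) + card bad"
    by (meson card_Un_le card_mono finite_UnI finite_imageI le_trans)
  then have cardG: "block_bound m + 3 \<le> card G"
    using big card_bad card_image_le[OF finG, of "\<lambda>C. {C}"] by linarith
  have G: "C \<in> comps" "{C} \<in> branches S" "C \<in> S" if "C \<in> G" for C
    using that branch_trace[of "{C}" S] unfolding G_def by auto
  have good: "\<not> mixed u C" if "C \<in> G" "u \<in> far v" for u C
    using that unfolding G_def bad_def by auto
  have big_trace: "S \<subseteq> trace w \<and> {C} \<subset> trace w"
    if "C \<in> G" "w \<in> far v" "C \<in> trace w" "w \<notin> Q C" for w C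
  proof -
    have sup: "{C} \<subset> trace w" using that unfolding Q_def by blast
    then have "\<not> trace w \<subset> S" using branch_maximal[OF G(2)[OF that(1)] imageI[OF that(2)]] by blast
    moreover have "trace w \<subseteq> S \<or> S \<subseteq> trace w"
      using S
    proof
      assume "S \<in> trace ` far v"
      then obtain s where "s \<in> far v" "S = trace s" by blast
      then show ?thesis using trace_laminar[OF that(2), of s] G(3)[OF that(1)] that(3) by blast
    qed (use trace_comps in blast)
    ultimately show ?thesis using sup by blast
  qed
  have P_V: "C \<subseteq> V" if "C \<in> G" for C using G(1)[OF that] comp_sub Y_sub by blast
  have same: "u \<frown> c" if "C \<in> G" "u \<in> Q C" "c \<in> C" for C u c
  proof -
    have "C \<in> trace u" "u \<in> far v" using that(2) unfolding Q_def by auto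
    moreover obtain d where "d \<in> C" "u \<frown> d" using \<open>C \<in> trace u\<close> by (rule traceE)
    ultimately show ?thesis using good[OF that(1)] that(3) unfolding mixed_def by blast
  qed
  have PQ: "\<not> u \<frown> c" if "C \<in> G" "D \<in> G" "C \<noteq> D" "c \<in> C" "u \<in> Q D" for C D c u
    using traceI[OF G(1)[OF that(1)] that(4), of u] that(3,5) unfolding Q_def by auto
  have "card G \<le> block_bound m"
  proof (rule few_blocks[where P = "\<lambda>C. C" and Q = Q])
    show "finite G" by (rule finG)
    show "C \<subseteq> V" "C \<noteq> {}" "Q C \<subseteq> V" if "C \<in> G" for C
      using P_V[OF that] comp_nonempty[OF G(1)[OF that]] unfolding Q_def far_def by auto
    show "x \<frown> y" if "C \<in> G" "x \<in> C" "y \<in> Q C" for C x y using same sym that by blast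
    show "x \<frown> y" if "C \<in> G" "D \<in> G" "C \<noteq> D" "x \<in> C" "y \<in> D" for C D x y
      using comps_complete G(1) that by blast
    show "x \<frown> y" if "C \<in> G" "D \<in> G" "C \<noteq> D" "x \<in> Q C" "y \<in> Q D" for C D x y
      using QQ that by blast
    show "\<not> x \<frown> y" if "C \<in> G" "D \<in> G" "C \<noteq> D" "x \<in> C" "y \<in> Q D" for C D x y
      using PQ[OF that] sym by blast
    show "C \<inter> Q D = {}" if "C \<in> G" "D \<in> G" for C D
      using comp_adj[OF G(1)[OF that(1)]] farD(2) unfolding Q_def by blast
  next
    fix w C D x y
    assume w: "w \<in> V" "w \<notin> (\<Union>C\<in>G. C \<union> Q C)" and C: "C \<in> G" "D \<in> G" "C \<noteq> D"
      and x: "x \<in> C" and y: "y \<in> D" and adj: "w \<frown> y"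
    have xy: "x \<in> Y" "y \<in> Y" using comp_sub G(1) C x y by blast+
    consider "w = v" | "w \<in> far v" | "w \<in> Y" | "v \<frown> w" "w \<notin> Y" using w unfolding far_def by blast
    then show "w \<frown> x"
    proof cases
      case 1
      then show ?thesis using xy v_adj by blast
    next
      case 2
      have "D \<in> trace w" using traceI[OF G(1)[OF C(2)] y adj] .
      moreover have "w \<notin> Q D" using w(2) C(2) by blast
      ultimately have "S \<subseteq> trace w" using big_trace[OF C(2) 2] by blast
      then have "C \<in> trace w" "trace w \<noteq> {C}" using G(3)[OF C(1)] G(3)[OF C(2)] C(3) by blast+
      then show ?thesis using trace_complete[OF 2] x by blast
    next
      case 3
      then obtain B where B: "B \<in> comps" "w \<in> B" by (rule comp_obtain)
      have "B \<noteq> C" using w(2) C(1) B(2) by blast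
      then show ?thesis using comps_complete[OF B(1) G(1)[OF C(1)] _ B(2) x] by blast
    next
      case 4
      then show ?thesis using is_node w(1) xy adj unfolding node_def by blast
    qed
  next
    fix w C D x y
    assume w: "w \<in> V" "w \<notin> (\<Union>C\<in>G. C \<union> Q C)" and C: "C \<in> G" "D \<in> G" "C \<noteq> D"
      and x: "x \<in> Q C" and y: "y \<in> Q D" and adj: "w \<frown> y"
    have far: "x \<in> far v" "y \<in> far v" and tr: "trace x = {C}" "trace y = {D}"
      using x y unfolding Q_def by auto
    have xy: "x \<frown> y" using QQ[OF C x y] .
    obtain c d where cd: "c \<in> C" "d \<in> D" using comp_nonempty G(1) C by blast
    have cd_adj: "x \<frown> c" "\<not> y \<frown> c" "y \<frown> d" using same[OF C(1) x] same[OF C(2) y] PQ[OF C cd(1) y] cd by blast+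
    have v_c: "v \<frown> c" using comp_adj[OF G(1)[OF C(1)] cd(1)] .
    consider "w = v" | "w \<in> far v" | "w \<in> Y" | "v \<frown> w" "w \<notin> Y" using w unfolding far_def by blast
    then show "w \<frown> x"
    proof cases
      case 1
      then show ?thesis using adj farD(2)[OF far(2)] by blast
    next
      case 2
      have notQ: "w \<notin> Q C" "w \<notin> Q D" using w(2) C by blast+
      have nD: "D \<notin> trace w"
      proof
        assume "D \<in> trace w"
        then have "{D} \<subset> trace w" using big_trace[OF C(2) 2] notQ by blast
        then show False using nested_nonadjacent[OF 2 far(2)] tr(2) adj by blast
      qed
      then have nC: "C \<notin> trace w" using big_trace[OF C(1) 2 _ notQ(1)] G(3)[OF C(2)] by blast
      show ?thesis
      proof (cases "trace w = {}")
        case True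
        have "\<not> w \<frown> c" using traceI[OF G(1)[OF C(1)] cd(1)] nC by blast
        then show ?thesis
          using no_P5[of w y x c v] adj xy cd_adj v_c farD(3)[OF 2] farD(3)[OF far(1)] farD(3)[OF far(2)] sym by blast
      next
        case False
        show ?thesis
          by (rule disjoint_traces_triple[OF 2 far(2,1) _ False _ _ _ adj]) (use tr nC nD C(3) in auto)
      qed
    next
      case 3
      then obtain B where B: "B \<in> comps" "w \<in> B" by (rule comp_obtain)
      have "B \<in> trace y" using traceI[OF B] adj sym by blast
      then show ?thesis using tr(2) w(2) C(2) B(2) by blast
    next
      case 4
      have "c \<in> Y" "d \<in> Y" using comp_sub G(1) C cd by blast+
      then have "mixed y Y" using cd_adj unfolding mixed_def by blast
      moreover have "y \<frown> w" using adj sym by blast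
      ultimately have anti: "\<forall>y\<in>Y. \<not> w \<frown> y"
        using is_node w(1) 4 far(2) unfolding node_def by blast
      \<comment> \<open>The path \<open>x, y, w, v, b\<close> needs a neighbour \<open>b\<close> of \<open>v\<close> in a third block.\<close>
      have "card {C, D} \<le> 2" by (simp add: card_insert_if)
      then have "card {C, D} < card G" using cardG by linarith
      then have "\<not> G \<subseteq> {C, D}" by (meson card_mono finite.emptyI finite.insertI leD)
      then obtain B where B: "B \<in> G" "B \<noteq> C" "B \<noteq> D" by blast
      obtain b where b: "b \<in> B" using comp_nonempty G(1)[OF B(1)] by blast
      have "\<not> x \<frown> b" "\<not> y \<frown> b" using PQ[OF B(1) C(1) B(2) b x] PQ[OF B(1) C(2) B(3) b y] by blast+
      moreover have "\<not> w \<frown> b" using anti comp_sub[OF G(1)[OF B(1)] b] by blast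
      moreover have "v \<frown> b" using comp_adj[OF G(1)[OF B(1)] b] .
      ultimately show ?thesis
        using no_P5[of x y w v b] xy \<open>y \<frown> w\<close> 4(1) farD(3)[OF far(1)] farD(3)[OF far(2)] sym by blast
    qed
  qed
  then show False using cardG by simp
qed

text \<open>
  A vertex that separates \<open>C\<close> from \<open>D\<close> has its trace inside \<open>S\<close>, hence inside some branch of \<open>S\<close>.
\<close>

lemma outside_branches:
  assumes S: "S = comps \<or> S \<in> trace ` far v" and C: "C \<in> S - \<Union> (branches S)" "D \<in> S - \<Union> (branches S)"
  shows "C = D"
proof (rule ccontr)
  assume "C \<noteq> D"
  have sub: "S \<subseteq> comps" using S trace_comps by blast
  obtain w where w: "w \<in> far v" "C \<in> trace w \<longleftrightarrow> D \<notin> trace w"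
    using comps_separated[of C D] sub C \<open>C \<noteq> D\<close> by blast
  obtain A B where AB: "A \<in> S - \<Union> (branches S)" "A \<in> trace w" "B \<in> S" "B \<notin> trace w"
    using w(2) C by blast
  have "trace w \<subseteq> S"
    using S
  proof
    assume "S \<in> trace ` far v"
    then obtain s where "s \<in> far v" "S = trace s" by blast
    then show ?thesis using trace_laminar[OF w(1), of s] AB by blast
  qed (use trace_comps in blast)
  then have w_in: "trace w \<in> {K \<in> trace ` far v. K \<subset> S}" using AB w by blast
  have "finite {K \<in> trace ` far v. K \<subset> S}"
    using finite_V unfolding far_def by simp
  then obtain J where J: "J \<in> {K \<in> trace ` far v. K \<subset> S}" "trace w \<subseteq> J"
    "\<forall>K\<in>{K \<in> trace ` far v. K \<subset> S}. J \<subseteq> K \<longrightarrow> J = K"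
    using finite_has_maximal2[OF _ w_in] by blast
  have "J \<in> branches S" using J AB(2) unfolding branches_def by blast
  then show False using AB J by blast
qed

lemma finite_S: "S = comps \<or> S \<in> trace ` far v \<Longrightarrow> finite S"
  using finite_comps finite_subset[OF trace_comps finite_comps] by blast

lemma branches_extend:
  assumes S: "S = comps \<or> S \<in> trace ` far v" and T: "T \<subseteq> far v" "stable_set (\<frown>) T" "\<And>t. t \<in> T \<Longrightarrow> S \<subseteq> trace t"
    and J: "J \<in> branches S"
  shows "\<exists>u. u \<in> far v \<and> trace u = J \<and> insert u T \<subseteq> far v \<and> stable_set (\<frown>) (insert u T) \<and>
    card (insert u T) = Suc (card T) \<and> Suc (card T) \<le> Suc m"
proof -
  obtain u where u: "u \<in> far v" "trace u = J" using branchE[OF J] .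
  have nest: "trace u \<noteq> {}" "trace u \<subset> S" using branch_trace[OF J] u(2) by auto
  have V: "insert u T \<subseteq> far v" using u T by blast
  have non: "\<not> t \<frown> u" if "t \<in> T" for t
    using nested_nonadjacent[of t u] T(1,3) that u(1) nest by blast
  then have "stable_set (\<frown>) (insert u T)"
    using T(2) irrefl sym unfolding stable_set_def by blast
  moreover have "far v \<subseteq> V" unfolding far_def by blast
  then have "finite T" using T(1) finite_V by (meson finite_subset)
  moreover have "u \<notin> T" using T(3) nest by blast
  moreover have "insert u T \<subseteq> V" using V unfolding far_def by blast
  ultimately have "stable_set (\<frown>) (insert u T)" "card (insert u T) = Suc (card T)" "card (insert u T) \<le> Suc m"
    using stable_card[of "insert u T"] by auto
  then show ?thesis using u V by (intro exI[of _ u]) simp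
qed

text \<open>
  The stable set \<open>T\<close> collects one vertex for each trace on the way down the tree to \<open>S\<close>; \<open>n\<close> is what
  remains of the greatest possible size \<open>m + 1\<close> of stable sets.
\<close>

lemma card_le_chain_bound:
  assumes "S = comps \<or> S \<in> trace ` far v" "T \<subseteq> far v" "stable_set (\<frown>) T" "\<And>t. t \<in> T \<Longrightarrow> S \<subseteq> trace t"
    "card T + n = Suc m"
  shows "card S \<le> chain_bound (block_bound m + m + 3) n"
  using assms
proof (induction n arbitrary: S T)
  case (0 S T)
  note S = 0(1)
  have "branches S = {}"
    using branches_extend[OF 0(1-4)] 0(5) by fastforce
  then have "card S \<le> 1"
    using outside_branches[OF S] by (simp add: card_le_Suc0_iff_eq finite_S[OF S])
  then show ?case by simp
next
  case (Suc n S T)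
  note S = Suc.prems(1)
  let ?R = "block_bound m + m + 3"
  have "card J \<le> chain_bound ?R n" if J: "J \<in> branches S" for J
  proof -
    obtain u where u: "u \<in> far v" "trace u = J" "insert u T \<subseteq> far v" "stable_set (\<frown>) (insert u T)"
      "card (insert u T) = Suc (card T)"
      using branches_extend[OF Suc.prems(1-4) J] by blast
    show ?thesis
    proof (rule Suc.IH[OF _ u(3,4)])
      show "J = comps \<or> J \<in> trace ` far v" using u by blast
      show "J \<subseteq> trace t" if "t \<in> insert u T" for t
        using that u(2) branch_trace[OF J] Suc.prems(4)[of t] by blast
      show "card (insert u T) + n = Suc m" using u(5) Suc.prems(5) by simp
    qed
  qed
  then have "(\<Sum>J\<in>branches S. card J) \<le> card (branches S) * chain_bound ?R n"
    using sum_bounded_above[of "branches S" card] by simp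
  also have "\<dots> \<le> ?R * chain_bound ?R n"
    using few_branches[OF S] by (rule mult_right_mono) simp
  finally have "card (\<Union> (branches S)) \<le> ?R * chain_bound ?R n"
    using card_Union_le_sum_card[of "branches S"] by linarith
  moreover have "card (S - \<Union> (branches S)) \<le> 1"
    using outside_branches[OF S] by (simp add: card_le_Suc0_iff_eq finite_S[OF S])
  moreover have "card S \<le> card (\<Union> (branches S)) + card (S - \<Union> (branches S))"
  proof -
    have "S \<subseteq> \<Union> (branches S) \<union> (S - \<Union> (branches S))" by blast
    moreover have "\<Union> (branches S) \<subseteq> S" using branch_trace by blast
    ultimately show ?thesis
      using finite_S[OF S] by (metis Diff_partition card_Un_le)
  qed
  ultimately show ?case by simp
qed

lemma card_comps: "card comps \<le> chain_bound (block_bound m + m + 3) (Suc m)"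
  by (rule card_le_chain_bound[where T = "{}"]) (auto simp: stable_set_def)

end

section \<open>Bounding the number of vertices\<close>

text \<open>
  Here \<open>n\<close> bounds the size of stable sets in the node. Each component of non-adjacency has
  either one vertex or at most \<open>m + 1\<close> components of \<open>\<frown>\<close>, which are nodes whose stable sets are
  smaller.
\<close>

primrec node_bound :: "nat \<Rightarrow> nat \<Rightarrow> nat" where
  "node_bound m 0 = 0"
| "node_bound m (Suc n) =
     chain_bound (block_bound m + m + 3) (Suc m) * (1 + Suc m * node_bound m n)"

context P5_gem_free_critical
begin

lemma node_locale: "node v Y \<Longrightarrow> neighbourhood_node V (\<frown>) m v Y"
  by unfold_locales

lemma path4_free_neighbourhood:
  assumes "\<And>x. x \<in> C \<Longrightarrow> v \<frown> x" shows "path4_free (\<frown>) C"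
  using no_gem[of v] assms unfolding path4_free_def by blast

text \<open>
  If \<open>w\<close> lies in another component \<open>B\<close> of the node than \<open>K \<subseteq> C\<close>, then it is joined to all of \<open>C\<close>, and
  a vertex mixed on \<open>K\<close> is mixed on \<open>C\<close>, so it avoids \<open>w\<close> by \<open>mixed_avoids\<close>. Vertices outside the node
  inherit their behaviour from it, and a vertex of \<open>C - K\<close> is not joined to \<open>K\<close>.
\<close>

lemma child_node:
  assumes Y: "node v Y" and C: "C \<in> components (nonadj (\<frown>)) Y" and K: "K \<in> components (\<frown>) C"
  shows "node v K"
proof -
  interpret neighbourhood_node V "(\<frown>)" m v Y using node_locale[OF Y] .
  have C': "C \<in> comps" using C unfolding comps_def .
  have KC: "K \<subseteq> C" "K \<noteq> {}" using component_subset[OF symp_adj K] component_nonempty[OF symp_adj K] by auto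
  have "(\<forall>y\<in>K. \<not> w \<frown> y) \<or> ((\<forall>y\<in>K. w \<frown> y) \<and> (\<forall>u\<in>far v. mixed u K \<longrightarrow> \<not> u \<frown> w))"
    if w: "w \<in> V" "v \<frown> w" "w \<notin> K" for w
  proof -
    consider "w \<in> C" | "w \<in> Y" "w \<notin> C" | "w \<notin> Y" by blast
    then show ?thesis
    proof cases
      case 1
      then obtain L where L: "L \<in> components (\<frown>) C" "w \<in> L" by (rule obtain_component[OF symp_adj])
      then have "L \<noteq> K" using w(3) by blast
      then show ?thesis using components_not_related[OF symp_adj L(1) K _ L(2)] by blast
    next
      case 2
      obtain B where B: "B \<in> comps" "w \<in> B" using 2(1) by (rule comp_obtain)
      have "B \<noteq> C" using B 2 by blast
      then have complete: "w \<frown> c" if "c \<in> C" for c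
        using comps_complete[OF B(1) C' _ B(2) that] by blast
      have "\<not> u \<frown> w" if u: "u \<in> far v" "mixed u K" for u
      proof -
        have "mixed u C" using u(2) KC(1) unfolding mixed_def by blast
        then obtain a b where ab: "a \<in> C" "b \<in> C" "u \<frown> a" "\<not> u \<frown> b" "nonadj (\<frown>) a b"
          by (rule mixed_edge[OF C'])
        show ?thesis
          by (rule mixed_avoids[of v a b w u])
            (use ab complete comp_adj[OF C'] w(2) farD(2)[OF u(1)] in auto)
      qed
      then show ?thesis using complete KC(1) by blast
    next
      case 3
      have "K \<subseteq> Y" using KC(1) comp_sub[OF C'] by blast
      moreover have "mixed u Y" if "mixed u K" for u using that calculation unfolding mixed_def by blast
      ultimately show ?thesis using Y w 3 unfolding node_def by blast
    qed
  qed
  moreover have "K \<subseteq> {x \<in> V. v \<frown> x}" using KC(1) comp_sub[OF C'] Y_sub v_adj by blast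
  ultimately show ?thesis unfolding node_def using v_in_V by blast
qed

lemma card_components_le:
  assumes "C \<subseteq> V" shows "card (components (\<frown>) C) \<le> Suc m"
proof -
  have "\<forall>K\<in>components (\<frown>) C. \<exists>x. x \<in> K"
    using component_nonempty[OF symp_adj] by blast
  then obtain r where r: "\<And>K. K \<in> components (\<frown>) C \<Longrightarrow> r K \<in> K" by metis
  have "inj_on r (components (\<frown>) C)"
  proof (rule inj_onI)
    fix K L assume "K \<in> components (\<frown>) C" "L \<in> components (\<frown>) C" "r K = r L"
    then show "K = L" using components_eqI[OF symp_adj, of K C L "r K"] r[of K] r[of L] by simp
  qed
  then have "card (components (\<frown>) C) = card (r ` components (\<frown>) C)" by (simp add: card_image)
  moreover have "r ` components (\<frown>) C \<subseteq> V"
    using r component_subset[OF symp_adj] assms by blast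
  moreover have "stable_set (\<frown>) (r ` components (\<frown>) C)"
    unfolding stable_set_def
  proof (intro ballI)
    fix x y assume "x \<in> r ` components (\<frown>) C" "y \<in> r ` components (\<frown>) C"
    then obtain K L where KL: "K \<in> components (\<frown>) C" "L \<in> components (\<frown>) C" "x = r K" "y = r L" by blast
    show "\<not> x \<frown> y"
    proof (cases "K = L")
      case False
      then show ?thesis
        using components_not_related[OF symp_adj KL(1,2) False r[OF KL(1)] r[OF KL(2)]] KL by simp
    qed (use KL irrefl in simp)
  qed
  ultimately show ?thesis using stable_card by simp
qed

text \<open>
  Being connected by non-adjacency and without induced path on four vertices, \<open>C\<close> is
  disconnected in \<open>\<frown>\<close>.
\<close>

lemma component_proper:
  assumes C: "linked (nonadj (\<frown>)) C" "2 \<le> card C" "\<And>x. x \<in> C \<Longrightarrow> v \<frown> x"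
    and K: "K \<in> components (\<frown>) C"
  shows "K \<subset> C"
proof -
  have "finite C" using C(2) by (intro card_ge_0_finite) simp
  then have "separated (\<frown>) C"
    using separated_if_path4_free[OF _ symp_adj path4_free_neighbourhood[OF C(3)] C(2)]
      not_separated_if_linked[OF C(1)] by blast
  then have "K \<noteq> C"
    using not_separated_if_linked linked_component[OF symp_adj K] by blast
  then show ?thesis using component_subset[OF symp_adj K] by blast
qed

lemma node_card:
  assumes "node v Y" "\<And>S. S \<subseteq> Y \<Longrightarrow> stable_set (\<frown>) S \<Longrightarrow> card S \<le> n"
  shows "card Y \<le> node_bound m n"
  using assms
proof (induction n arbitrary: Y)
  case (0 Y)
  have "Y = {}"
  proof (rule equals0I)
    fix y assume "y \<in> Y"
    then show False using 0(2)[of "{y}"] irrefl by (simp add: stable_set_def)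
  qed
  then show ?case by simp
next
  case (Suc n Y)
  interpret neighbourhood_node V "(\<frown>)" m v Y using node_locale[OF Suc.prems(1)] .
  have "card C \<le> 1 + Suc m * node_bound m n" if C: "C \<in> comps" for C
  proof (cases "2 \<le> card C")
    case True
    have C': "C \<in> components (nonadj (\<frown>)) Y" using C unfolding comps_def .
    have CV: "C \<subseteq> V" using comp_sub[OF C] Y_sub by blast
    have "card K \<le> node_bound m n" if K: "K \<in> components (\<frown>) C" for K
    proof (rule Suc.IH[OF child_node[OF Suc.prems(1) C' K]])
      fix S assume S: "S \<subseteq> K" "stable_set (\<frown>) S"
      have "K \<subset> C"
        using component_proper[OF linked_component[OF symp_non C'] True comp_adj[OF C] K] .
      then obtain z where z: "z \<in> C" "z \<notin> K" by blast
      \<comment> \<open>A vertex \<open>z\<close> of another component enlarges every stable set of \<open>K\<close>.\<close>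
      obtain L where L: "L \<in> components (\<frown>) C" "z \<in> L" using obtain_component[OF symp_adj z(1)] .
      have "L \<noteq> K" using L z by blast
      then have "\<not> z \<frown> x" if "x \<in> S" for x
        using components_not_related[OF symp_adj L(1) K _ L(2)] S(1) that by blast
      then have "stable_set (\<frown>) (insert z S)"
        using S(2) irrefl sym unfolding stable_set_def by blast
      moreover have sub: "insert z S \<subseteq> Y" using S(1) \<open>K \<subset> C\<close> z comp_sub[OF C] by blast
      ultimately have "card (insert z S) \<le> Suc n" using Suc.prems(2) by blast
      moreover have "finite S" using sub finite_Y by (meson finite_subset subset_insertI subset_trans)
      moreover have "z \<notin> S" using S(1) z by blast
      ultimately show "card S \<le> n" by simp
    qed
    then have "(\<Sum>K\<in>components (\<frown>) C. card K) \<le> card (components (\<frown>) C) * node_bound m n"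
      using sum_bounded_above[of "components (\<frown>) C" card] by simp
    also have "\<dots> \<le> Suc m * node_bound m n"
      using card_components_le[OF CV] by (rule mult_right_mono) simp
    finally have "card (\<Union> (components (\<frown>) C)) \<le> Suc m * node_bound m n"
      using card_Union_le_sum_card[of "components (\<frown>) C"] by linarith
    then show ?thesis using Union_components[OF symp_adj] by simp
  qed simp
  then have "(\<Sum>C\<in>comps. card C) \<le> card comps * (1 + Suc m * node_bound m n)"
    using sum_bounded_above[of comps card "1 + Suc m * node_bound m n"] by (simp only: of_nat_id)
  also have "\<dots> \<le> chain_bound (block_bound m + m + 3) (Suc m) * (1 + Suc m * node_bound m n)"
    using card_comps by (rule mult_right_mono) simp
  finally have "card (\<Union> comps) \<le> node_bound m (Suc n)"
    using card_Union_le_sum_card[of comps] by (simp only: node_bound.simps)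
  then show ?case using Union_components[OF symp_non] unfolding comps_def by simp
qed

lemma card_neighbourhood:
  assumes "v \<in> V" shows "card {x \<in> V. v \<frown> x} \<le> node_bound m (Suc m)"
proof (rule node_card)
  show "node v {x \<in> V. v \<frown> x}" using assms unfolding node_def by blast
  show "card S \<le> Suc m" if "S \<subseteq> {x \<in> V. v \<frown> x}" "stable_set (\<frown>) S" for S
    using stable_card[OF _ that(2)] that(1) by blast
qed

theorem card_V: "card V \<le> Suc m * (1 + node_bound m (Suc m))"
proof -
  have fin: "finite {S. S \<subseteq> V \<and> stable_set (\<frown>) S}" using finite_V by simp
  have empty: "{} \<in> {S. S \<subseteq> V \<and> stable_set (\<frown>) S}" unfolding stable_set_def by simp
  from finite_has_maximal2[OF fin empty] obtain Q where Q: "Q \<in> {S. S \<subseteq> V \<and> stable_set (\<frown>) S}"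
    "\<forall>S\<in>{S. S \<subseteq> V \<and> stable_set (\<frown>) S}. Q \<subseteq> S \<longrightarrow> Q = S"
    by blast
  have "V \<subseteq> (\<Union>q\<in>Q. insert q {x \<in> V. q \<frown> x})"
  proof
    fix x assume x: "x \<in> V"
    show "x \<in> (\<Union>q\<in>Q. insert q {x \<in> V. q \<frown> x})"
    proof (rule ccontr)
      assume no: "x \<notin> (\<Union>q\<in>Q. insert q {x \<in> V. q \<frown> x})"
      then have "\<not> q \<frown> x" if "q \<in> Q" for q using that x by blast
      then have "stable_set (\<frown>) (insert x Q)" using Q(1) irrefl sym unfolding stable_set_def by blast
      then have "Q = insert x Q" using Q x by blast
      then show False using no by blast
    qed
  qed
  moreover have finQ: "finite Q" using Q(1) finite_V by (auto intro: finite_subset)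
  moreover have "finite (\<Union>q\<in>Q. insert q {x \<in> V. q \<frown> x})" using finQ finite_V by simp
  ultimately have "card V \<le> card (\<Union>q\<in>Q. insert q {x \<in> V. q \<frown> x})" by (intro card_mono)
  also have "\<dots> \<le> (\<Sum>q\<in>Q. card (insert q {x \<in> V. q \<frown> x}))" using finQ by (rule card_UN_le)
  also have "\<dots> \<le> card Q * (1 + node_bound m (Suc m))"
  proof -
    have "card (insert q {x \<in> V. q \<frown> x}) \<le> 1 + node_bound m (Suc m)" if "q \<in> Q" for q
    proof -
      have "card (insert q {x \<in> V. q \<frown> x}) \<le> Suc (card {x \<in> V. q \<frown> x})" by (rule card_insert_le_m1) simp_all
      then show ?thesis using card_neighbourhood[of q] that Q(1) by auto
    qed
    then show ?thesis
      using sum_bounded_above[of Q "\<lambda>q. card (insert q {x \<in> V. q \<frown> x})" "1 + node_bound m (Suc m)"]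
      by (simp only: of_nat_id)
  qed
  also have "\<dots> \<le> Suc m * (1 + node_bound m (Suc m))"
    using stable_card[of Q] Q(1) by (intro mult_right_mono) auto
  finally show ?thesis .
qed

end

section \<open>From graphs to their complements\<close>

text \<open>
  Restricting the relation to the vertices makes it symmetric and irreflexive on the whole
  type.
\<close>

definition co_adj :: "('a, 'b) pre_digraph \<Rightarrow> 'a \<Rightarrow> 'a \<Rightarrow> bool" where
  "co_adj G x y \<longleftrightarrow> x \<in> verts G \<and> y \<in> verts G \<and> x \<noteq> y \<and> (x, y) \<notin> arcs_ends G"

text \<open>
  An adjacency-preserving embedding of vertices suffices, because without parallel arcs it
  determines the images of the arcs.
\<close>

lemma not_induced_free:
  assumes "graph G" and H: "parcs H \<subseteq> pverts H \<times> pverts H"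
    and h: "inj_on h (pverts H)" "h ` pverts H \<subseteq> verts G"
    and adj: "\<And>x y. x \<in> pverts H \<Longrightarrow> y \<in> pverts H \<Longrightarrow> (x, y) \<in> parcs H \<longleftrightarrow> (h x, h y) \<in> arcs_ends G"
  shows "\<not> induced_free (with_proj H) G"
proof -
  interpret graph G by fact
  define K where "K = \<lparr>verts = h ` pverts H,
    arcs = {a \<in> arcs G. tail G a \<in> h ` pverts H \<and> head G a \<in> h ` pverts H}, tail = tail G, head = head G\<rparr>"
  define arc where "arc x y = (THE a. a \<in> arcs G \<and> tail G a = h x \<and> head G a = h y)" for x y
  have arc_unique: "arc x y = a" if "a \<in> arcs G" "tail G a = h x" "head G a = h y" for a x y
    unfolding arc_def by (rule the_equality) (use that no_multi_arcs in \<open>auto simp: arc_to_ends_def\<close>)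
  have arc: "arc x y \<in> arcs G \<and> tail G (arc x y) = h x \<and> head G (arc x y) = h y" if "(x, y) \<in> parcs H" for x y
  proof -
    have "(h x, h y) \<in> arcs_ends G" using adj H that by blast
    then obtain a where "a \<in> arcs G" "tail G a = h x" "head G a = h y" by (auto simp: arcs_ends_conv)
    then show ?thesis using arc_unique by simp
  qed
  define f where "f = \<lparr>iso_verts = h, iso_arcs = (\<lambda>(x, y). arc x y), iso_head = head G, iso_tail = tail G\<rparr>"
  have "wf_digraph K" unfolding K_def by unfold_locales auto
  then have "induced_subgraph K G"
    unfolding induced_subgraph_def subgraph_def compatible_def
    using h wf_digraph by (auto simp: K_def)
  moreover have "wf_digraph (with_proj H)"
    by unfold_locales (use H in auto)
  moreover have "inj_on (\<lambda>(x, y). arc x y) (parcs H)"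
  proof (rule inj_onI, clarify)
    fix x y x' y' assume *: "(x, y) \<in> parcs H" "(x', y') \<in> parcs H" "arc x y = arc x' y'"
    then have "h x = h x'" "h y = h y'" using arc by metis+
    then show "x = x' \<and> y = y'" using * H h(1) unfolding inj_on_def by blast
  qed
  then have "pre_digraph.digraph_isomorphism (with_proj H) f"
    unfolding pre_digraph.digraph_isomorphism_def
    using \<open>wf_digraph (with_proj H)\<close> h(1) arc by (auto simp: f_def)
  moreover have "K = app_iso f (with_proj H)"
  proof -
    have "a \<in> (\<lambda>(x, y). arc x y) ` parcs H"
      if a: "a \<in> arcs G" "tail G a = h x" "head G a = h y" "x \<in> pverts H" "y \<in> pverts H" for a x y
    proof -
      have "(h x, h y) \<in> arcs_ends G" using a by (auto simp: arcs_ends_conv intro: rev_image_eqI)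
      then have "(x, y) \<in> parcs H" using adj a by blast
      moreover have "a = arc x y" using arc_unique a by simp
      ultimately show ?thesis by (auto intro: rev_image_eqI)
    qed
    then have "arcs K = (\<lambda>(x, y). arc x y) ` parcs H"
      using arc H unfolding K_def by fastforce
    then show ?thesis by (intro pre_digraph.equality) (auto simp: f_def K_def app_iso_def)
  qed
  ultimately show ?thesis unfolding induced_free_def digraph_iso_def by blast
qed

context
  fixes G :: "('a, 'b) pre_digraph"
  assumes graph: "graph G"
begin

interpretation graph G by (rule graph)

lemma sym_ends: "(x, y) \<in> arcs_ends G \<Longrightarrow> (y, x) \<in> arcs_ends G"
  using arcs_ends_symmetric[OF sym_arcs] .

lemma ends_irrefl: "(x, x) \<notin> arcs_ends G"
  using adj_not_same by blast

text \<open>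
  The house is the complement of the path \<open>0, 1, 2, 3, 4\<close>, so the embedding lists the path in
  order.
\<close>

lemma co_adj_no_P5:
  assumes "induced_free (with_proj house) G"
    and "co_adj G a b" "co_adj G b c" "co_adj G c d" "co_adj G d f"
    "\<not> co_adj G a c" "\<not> co_adj G a d" "\<not> co_adj G a f" "\<not> co_adj G b d" "\<not> co_adj G b f" "\<not> co_adj G c f"
  shows False
proof -
  let ?h = "\<lambda>i. [a, b, c, d, f] ! i"
  have V: "a \<in> verts G" "b \<in> verts G" "c \<in> verts G" "d \<in> verts G" "f \<in> verts G"
    using assms(2-5) unfolding co_adj_def by auto
  have dist: "distinct [a, b, c, d, f]"
    using assms(2-11) sym_ends unfolding co_adj_def by auto
  have ends: "(a, b) \<notin> arcs_ends G" "(b, c) \<notin> arcs_ends G" "(c, d) \<notin> arcs_ends G" "(d, f) \<notin> arcs_ends G"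
    "(a, c) \<in> arcs_ends G" "(a, d) \<in> arcs_ends G" "(a, f) \<in> arcs_ends G"
    "(b, d) \<in> arcs_ends G" "(b, f) \<in> arcs_ends G" "(c, f) \<in> arcs_ends G"
    using assms(2-11) V dist unfolding co_adj_def by auto
  have sym_iff: "(y, x) \<in> arcs_ends G \<longleftrightarrow> (x, y) \<in> arcs_ends G" for x y using sym_ends by blast
  have five: "{..<5} = {0, 1, 2, 3, 4::nat}" by auto
  have "\<not> induced_free (with_proj house) G"
  proof (rule not_induced_free[OF graph, where h = ?h])
    show "parcs house \<subseteq> pverts house \<times> pverts house"
      by (auto simp: house_def graph_complement_def path_graph_def)
    show "inj_on ?h (pverts house)"
      using dist by (auto simp: house_def graph_complement_def path_graph_def five inj_on_def)
    show "?h ` pverts house \<subseteq> verts G"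
      using V by (auto simp: house_def graph_complement_def path_graph_def five)
    show "(x, y) \<in> parcs house \<longleftrightarrow> (?h x, ?h y) \<in> arcs_ends G"
      if "x \<in> pverts house" "y \<in> pverts house" for x y
      using that ends ends_irrefl sym_iff[of b a] sym_iff[of c b] sym_iff[of d c] sym_iff[of f d] sym_iff[of c a]
        sym_iff[of d a] sym_iff[of f a] sym_iff[of d b] sym_iff[of f b] sym_iff[of f c]
      by (simp add: house_def graph_complement_def path_graph_def five) (elim disjE; simp)
  qed
  then show False using assms(1) by blast
qed

text \<open>
  The complement of the path \<open>a, b, c, d\<close> is the path \<open>b, d, a, c\<close>, which is the order in which
  the embedding lists these vertices.
\<close>

lemma co_adj_no_gem:
  assumes "induced_free (with_proj co_gem) G"
    and "co_adj G w a" "co_adj G w b" "co_adj G w c" "co_adj G w d"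
     "co_adj G a b" "co_adj G b c" "co_adj G c d"
    "\<not> co_adj G a c" "\<not> co_adj G a d" "\<not> co_adj G b d"
  shows False
proof -
  let ?h = "case_sum (\<lambda>i. [b, d, a, c] ! i) (\<lambda>_::nat. w)"
  have V: "w \<in> verts G" "a \<in> verts G" "b \<in> verts G" "c \<in> verts G" "d \<in> verts G"
    using assms(2-5) unfolding co_adj_def by auto
  have dist: "distinct [a, b, c, d, w]"
    using assms(2-11) sym_ends unfolding co_adj_def by auto
  have ends: "(w, a) \<notin> arcs_ends G" "(w, b) \<notin> arcs_ends G" "(w, c) \<notin> arcs_ends G" "(w, d) \<notin> arcs_ends G"
    "(a, b) \<notin> arcs_ends G" "(b, c) \<notin> arcs_ends G" "(c, d) \<notin> arcs_ends G"
    "(a, c) \<in> arcs_ends G" "(a, d) \<in> arcs_ends G" "(b, d) \<in> arcs_ends G"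
    using assms(2-11) V dist unfolding co_adj_def by auto
  have sym_iff: "(y, x) \<in> arcs_ends G \<longleftrightarrow> (x, y) \<in> arcs_ends G" for x y using sym_ends by blast
  have four: "{..<4} = {0, 1, 2, 3::nat}" by auto
  have verts_co_gem: "pverts co_gem = {Inl 0, Inl 1, Inl 2, Inl 3, Inr 0}"
    by (auto simp: co_gem_def disjoint_union_def path_graph_def four)
  have arcs_co_gem: "parcs co_gem = {(Inl 0, Inl 1), (Inl 1, Inl 2), (Inl 2, Inl 3),
      (Inl 1, Inl 0), (Inl 2, Inl 1), (Inl 3, Inl 2)}" (is "_ = ?A")
  proof -
    have "parcs P\<^bsub>4\<^esub> = {(0, 1), (1, 2), (2, 3), (1, 0), (2, 1), (3, 2)}"
      by (auto simp: path_graph_def)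
    moreover have "parcs P\<^bsub>1\<^esub> = {}" by (auto simp: path_graph_def)
    ultimately show ?thesis by (simp add: co_gem_def disjoint_union_def)
  qed
  have "\<not> induced_free (with_proj co_gem) G"
  proof (rule not_induced_free[OF graph, where h = ?h])
    show "parcs co_gem \<subseteq> pverts co_gem \<times> pverts co_gem"
      unfolding verts_co_gem arcs_co_gem by auto
    show "inj_on ?h (pverts co_gem)"
      using dist unfolding verts_co_gem by (auto simp: inj_on_def)
    show "?h ` pverts co_gem \<subseteq> verts G"
      using V unfolding verts_co_gem by auto
    show "(x, y) \<in> parcs co_gem \<longleftrightarrow> (?h x, ?h y) \<in> arcs_ends G"
      if "x \<in> pverts co_gem" "y \<in> pverts co_gem" for x y
      using that ends ends_irrefl sym_iff[of a w] sym_iff[of b w] sym_iff[of c w] sym_iff[of d w]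
        sym_iff[of b a] sym_iff[of c b] sym_iff[of d c] sym_iff[of c a] sym_iff[of d a] sym_iff[of d b]
      unfolding verts_co_gem arcs_co_gem
      by simp (elim disjE; simp)
  qed
  then show False using assms(1) by blast
qed

lemma clique_colouring_co_adj:
  assumes "B \<subseteq> verts G"
  shows "clique_colouring (co_adj G) c B \<longleftrightarrow>
    (\<forall>x y. (x, y) \<in> arcs_ends G \<longrightarrow> x \<in> B \<longrightarrow> y \<in> B \<longrightarrow> c x \<noteq> c y)"
proof -
  have "x = y \<or> co_adj G x y \<longleftrightarrow> (x, y) \<notin> arcs_ends G" if "x \<in> B" "y \<in> B" for x y
    using that assms ends_irrefl unfolding co_adj_def by auto
  then show ?thesis unfolding clique_colouring_def by blast
qed

lemma proper_colouring_iff: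
  "proper_colouring G n c \<longleftrightarrow> c ` verts G \<subseteq> {..<n} \<and> clique_colouring (co_adj G) c (verts G)"
  unfolding proper_colouring_def clique_colouring_co_adj[OF subset_refl]
  using adj_in_verts by blast

lemma proper_colouring_del_vert_iff:
  "proper_colouring (del_vert v) n c \<longleftrightarrow>
     c ` (verts G - {v}) \<subseteq> {..<n} \<and> clique_colouring (co_adj G) c (verts G - {v})"
proof -
  have "arcs_ends (del_vert v) = {(x, y). (x, y) \<in> arcs_ends G \<and> x \<in> verts G - {v} \<and> y \<in> verts G - {v}}"
    unfolding arcs_ends_conv del_vert_def by auto
  moreover have "verts (del_vert v) = verts G - {v}" unfolding del_vert_def by simp
  ultimately show ?thesis
    unfolding proper_colouring_def clique_colouring_co_adj[OF Diff_subset] by auto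
qed

lemma coverable_verts: "coverable (co_adj G) (verts G) n \<longleftrightarrow> (\<exists>c. proper_colouring G n c)"
  unfolding coverable_def proper_colouring_iff by blast

lemma coverable_del_vert:
  "coverable (co_adj G) (verts G - {v}) n \<longleftrightarrow> (\<exists>c. proper_colouring (del_vert v) n c)"
  unfolding coverable_def proper_colouring_del_vert_iff by blast

lemma chromatic_number_verts: "chromatic_number G = theta (co_adj G) (verts G)"
  unfolding chromatic_number_def theta_def coverable_verts ..

lemma chromatic_number_del_vert: "chromatic_number (del_vert v) = theta (co_adj G) (verts G - {v})"
  unfolding chromatic_number_def theta_def coverable_del_vert ..

lemma critical_complement:
  assumes crit: "vertex_critical (Suc m) G"
    and free: "induced_free (with_proj co_gem) G" "induced_free (with_proj house) G"
  shows "P5_gem_free_critical (verts G) (co_adj G) m"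
proof
  show "finite (verts G)" by simp
  show "symp (co_adj G)" unfolding symp_def co_adj_def using sym_ends by blast
  show "\<not> co_adj G x x" for x unfolding co_adj_def by simp
  show "\<not> coverable (co_adj G) (verts G) m"
    using crit theta_le[of "co_adj G" "verts G" m] unfolding vertex_critical_def chromatic_number_verts by auto
  show "coverable (co_adj G) (verts G - {x}) m" if "x \<in> verts G" for x
  proof -
    have "theta (co_adj G) (verts G - {x}) \<le> m"
      using crit that unfolding vertex_critical_def chromatic_number_del_vert[symmetric] by auto
    with coverable_theta[of "verts G - {x}"] show ?thesis
      by (rule coverable_mono) simp
  qed
qed (use co_adj_no_P5[OF free(2)] co_adj_no_gem[OF free(1)] in \<open>assumption | blast\<close>)+

lemma isomorphic_copy:
  assumes "card (verts G) \<le> N"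
  obtains H where "pverts H \<subseteq> {..<N}" "parcs H \<subseteq> {..<N} \<times> {..<N}" "digraph_iso G (with_proj H)"
proof -
  obtain h where h: "bij_betw h (verts G) {..<card (verts G)}"
    using ex_bij_betw_finite_nat[OF finite_verts] atLeast0LessThan by metis
  define H where "H = \<lparr>pverts = h ` verts G, parcs = map_prod h h ` arcs_ends G\<rparr>"
  define f where "f = \<lparr>iso_verts = h, iso_arcs = (\<lambda>a. (h (tail G a), h (head G a))),
    iso_head = snd, iso_tail = fst\<rparr>"
  have inj: "inj_on h (verts G)" and im: "h ` verts G \<subseteq> {..<N}"
    using h assms by (auto simp: bij_betw_def)
  have "inj_on (\<lambda>a. (h (tail G a), h (head G a))) (arcs G)"
  proof (rule inj_onI)
    fix a a' assume "a \<in> arcs G" "a' \<in> arcs G" "(h (tail G a), h (head G a)) = (h (tail G a'), h (head G a'))"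
    then show "a = a'" using inj no_multi_arcs[of a a'] by (auto simp: inj_on_def arc_to_ends_def)
  qed
  then have "digraph_isomorphism f"
    unfolding digraph_isomorphism_def using inj wf_digraph by (auto simp: f_def)
  moreover have "with_proj H = app_iso f G"
    unfolding H_def f_def app_iso_def with_proj_def arcs_ends_conv by (auto simp: image_image)
  ultimately have "digraph_iso G (with_proj H)" unfolding digraph_iso_def by blast
  moreover have "pverts H \<subseteq> {..<N}" using im unfolding H_def by simp
  moreover have "(h x, h y) \<in> {..<N} \<times> {..<N}" if "(x, y) \<in> arcs_ends G" for x y
    using im adj_in_verts[OF that] by blast
  then have "parcs H \<subseteq> {..<N} \<times> {..<N}" unfolding H_def by auto
  ultimately show ?thesis using that by blast
qed

end

section \<open>Finiteness\<close>

lemma finite_pair_digraphs_on: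
  assumes "finite A" shows "finite {H :: 'a pair_pre_digraph. pverts H \<subseteq> A \<and> parcs H \<subseteq> A \<times> A}"
proof -
  have "{H :: 'a pair_pre_digraph. pverts H \<subseteq> A \<and> parcs H \<subseteq> A \<times> A}
      \<subseteq> (\<lambda>(X, R). \<lparr>pverts = X, parcs = R\<rparr>) ` (Pow A \<times> Pow (A \<times> A))"
  proof
    fix H :: "'a pair_pre_digraph" assume "H \<in> {H. pverts H \<subseteq> A \<and> parcs H \<subseteq> A \<times> A}"
    then show "H \<in> (\<lambda>(X, R). \<lparr>pverts = X, parcs = R\<rparr>) ` (Pow A \<times> Pow (A \<times> A))"
      by (intro rev_image_eqI[of "(pverts H, parcs H)"]) auto
  qed
  then show ?thesis by (rule finite_subset) (use assms in simp)
qed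

theorem theorem3:
  fixes k :: nat
  assumes "k \<ge> 1"
  shows "\<exists>F :: nat pair_pre_digraph set. finite F \<and>
    (\<forall>G :: ('a, 'b) pre_digraph.
       graph G \<and> vertex_critical k G \<and>
       induced_free (with_proj co_gem) G \<and> induced_free (with_proj house) G
       \<longrightarrow> (\<exists>H \<in> F. digraph_iso G (with_proj H)))"
proof -
  obtain m where m: "k = Suc m" using assms by (cases k) auto
  define N where "N = Suc m * (1 + node_bound m (Suc m))"
  define F where "F = {H :: nat pair_pre_digraph. pverts H \<subseteq> {..<N} \<and> parcs H \<subseteq> {..<N} \<times> {..<N}}"
  have "finite F" unfolding F_def by (rule finite_pair_digraphs_on) simp
  moreover have "\<exists>H\<in>F. digraph_iso G (with_proj H)"
    if G: "graph G" "vertex_critical k G" "induced_free (with_proj co_gem) G" "induced_free (with_proj house) G"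
    for G :: "('a, 'b) pre_digraph"
  proof -
    interpret P5_gem_free_critical "verts G" "co_adj G" m
      using critical_complement[OF G(1) _ G(3,4)] G(2) m by simp
    obtain H where "pverts H \<subseteq> {..<N}" "parcs H \<subseteq> {..<N} \<times> {..<N}" "digraph_iso G (with_proj H)"
      using isomorphic_copy[OF G(1)] card_V unfolding N_def by metis
    then show ?thesis unfolding F_def by blast
  qed
  ultimately show ?thesis by blast
qed

end
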